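(* Let $(\mathbb{R}^n,g)$ be a pseudo-Euclidean space, $n\ge3$, with coordinates $x=(x_1,\dots,x_n)$ and $g_{ij}=\delta_{ij}\varepsilon_i$, $\varepsilon_i=\pm1$. Let $\xi=\sum_{i=1}^n\alpha_ix_i$, $\alpha_i\in\mathbb{R}$, with $\sum_{i=1}^n\varepsilon_i\alpha_i^2=\pm1$. Let $m\ge1$ be an integer, let $k,c_3>0$ be constants, and let $a=\dfrac{k}{\sqrt{m+k^2(n-1)}}$. Let $x(\xi)$ and $z(\xi)$ be smooth functions on an open interval $I$, satisfying $$x=c_3\left(z+k-\sqrt{m+k^2(n-1)}\right)^{\frac{a-1}{2}}\left(z+k+\sqrt{m+k^2(n-1)}\right)^{-\frac{a+1}{2}},$$ $$z'=-c_3\left(z+k-\sqrt{m+k^2(n-1)}\right)^{\frac{a+1}{2}}\left(z+k+\sqrt{m+k^2(n-1)}\right)^{-\frac{a-1}{2}}.$$ Let $\varphi(\xi)$, $f(\xi)$, $h(\xi)$ be functions obtained by integrating $$\frac{\varphi'}{\varphi}(\xi)=k\frac{f'}{f}(\xi),\qquad\frac{f'}{f}(\xi)=x(\xi),\qquad h'(\xi)=[z(\xi)+m-k(n-2)]\,x(\xi),$$ with $f>0$ and $\varphi$ nowhere zero. Then the warped product $M=(\mathbb{R}^n,\overline g)\times_fF^m$ (with $\mathbb{R}^n$ replaced by the open set $\{\xi\in I\}$ on which the functions are defined), where $\overline g=\frac1{\varphi^2}g$ and $F^m$ is a Ricci-flat semi-Riemannian manifold of dimension $m$, is a steady gradient Ricci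 soliton with $h$ as potential function.
   Context: Here $'$ denotes $d/d\xi$; the function $x(\xi)$ is not to be confused with the coordinates $x_i$. Real powers are taken of positive bases, i.e. $z+k-\sqrt{m+k^2(n-1)}>0$ on $I$. A semi-Riemannian manifold $(M,\widetilde g)$ is a steady gradient Ricci soliton with potential function $h$ if $\mathrm{Ric}_{\widetilde g}+\mathrm{Hess}_{\widetilde g}(h)=0$. The warped product $B\times_fF$ of semi-Riemannian manifolds $(B,g_B)$, $(F,g_F)$ with warping function $f>0$ on $B$ is $B\times F$ with metric $g_B+f^2g_F$. Functions on the base are regarded as functions on $M$ via the projection. *)

theory Defs
  imports "HOL-Analysis.Analysis"
begin

section \<open>Smooth functions\<close>

text \<open>Only meant for open \<open>S\<close>: derivatives are taken in the ambient space.\<close>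

primrec Ck_on :: "nat \<Rightarrow> 'a::euclidean_space set \<Rightarrow> ('a \<Rightarrow> 'b::real_normed_vector) \<Rightarrow> bool" where
  "Ck_on 0 S f \<longleftrightarrow> continuous_on S f"
| "Ck_on (Suc k) S f \<longleftrightarrow>
     (\<forall>x\<in>S. f differentiable (at x)) \<and> (\<forall>v. Ck_on k S (\<lambda>x. frechet_derivative f (at x) v))"

definition smooth_on :: "'a::euclidean_space set \<Rightarrow> ('a \<Rightarrow> 'b::real_normed_vector) \<Rightarrow> bool" where
  "smooth_on S f \<longleftrightarrow> (\<forall>k. Ck_on k S f)"


section \<open>Metrics, connection and curvature in a coordinate domain\<close>

text \<open>A metric on a coordinate domain in the Euclidean space \<open>'e\<close> is a map \<open>g\<close>, with \<open>g x u v\<close> the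
  product at the point \<open>x\<close> of the tangent vectors with components \<open>u\<close> and \<open>v\<close>. In all of this
  section, a fixed vector \<open>u\<close> stands for the coordinate vector field with constant components
  \<open>u\<close>; such fields commute.\<close>

type_synonym 'e local_metric = "'e \<Rightarrow> 'e \<Rightarrow> 'e \<Rightarrow> real"

definition dir_deriv ::
  "('e::euclidean_space \<Rightarrow> 'b::real_normed_vector) \<Rightarrow> 'e \<Rightarrow> 'e \<Rightarrow> 'b" where
  "dir_deriv F x u = frechet_derivative F (at x) u"

text \<open>\<open>christoffel g x u v\<close> is the Levi-Civita derivative of the constant field \<open>v\<close> in direction
  \<open>u\<close>, characterised by the Koszul formula. For basis vectors \<open>e\<^sub>i\<close>, \<open>e\<^sub>j\<close> its \<open>e\<^sub>k\<close>-component is the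
  Christoffel symbol with lower indices \<open>i\<close>, \<open>j\<close> and upper index \<open>k\<close>. The vector \<open>w\<close> exists and is
  unique when \<open>g x\<close> is bilinear and nondegenerate.\<close>

definition christoffel :: "'e::euclidean_space local_metric \<Rightarrow> 'e \<Rightarrow> 'e \<Rightarrow> 'e \<Rightarrow> 'e" where
  "christoffel g x u v = (THE w. \<forall>t. g x w t =
     (dir_deriv (\<lambda>y. g y v t) x u + dir_deriv (\<lambda>y. g y u t) x v - dir_deriv (\<lambda>y. g y u v) x t) / 2)"

text \<open>The sign convention is \<open>R(u,v)w = \<nabla>\<^sub>u \<nabla>\<^sub>v w - \<nabla>\<^sub>v \<nabla>\<^sub>u w - \<nabla>\<^bsub>[u,v]\<^esub> w\<close>, and \<open>Ric(v,w)\<close> is the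
  trace of \<open>u \<mapsto> R(u,v)w\<close>, so that round spheres have positive Ricci curvature.\<close>

definition riemann :: "'e::euclidean_space local_metric \<Rightarrow> 'e \<Rightarrow> 'e \<Rightarrow> 'e \<Rightarrow> 'e \<Rightarrow> 'e" where
  "riemann g x u v w =
     dir_deriv (\<lambda>y. christoffel g y v w) x u - dir_deriv (\<lambda>y. christoffel g y u w) x v
     + christoffel g x u (christoffel g x v w) - christoffel g x v (christoffel g x u w)"

definition local_ricci :: "'e::euclidean_space local_metric \<Rightarrow> 'e \<Rightarrow> 'e \<Rightarrow> 'e \<Rightarrow> real" where
  "local_ricci g x v w = (\<Sum>b\<in>Basis. riemann g x b v w \<bullet> b)"

definition local_hess ::
  "'e::euclidean_space local_metric \<Rightarrow> ('e \<Rightarrow> real) \<Rightarrow> 'e \<Rightarrow> 'e \<Rightarrow> 'e \<Rightarrow> real" where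
  "local_hess g h x u v =
     dir_deriv (\<lambda>y. dir_deriv h y v) x u - dir_deriv h x (christoffel g x u v)"


section \<open>Semi-Riemannian manifolds\<close>

text \<open>A manifold with point set \<open>topspace (mtop M)\<close> is given by an atlas indexed by \<open>charts M\<close>; the
  chart \<open>i\<close> maps \<open>chart_dom M i\<close> onto an open subset of \<open>'e\<close>, and its values off \<open>chart_dom M i\<close> are
  irrelevant. The metric tensor is given by its expression \<open>metric M i\<close> in each chart.\<close>

record ('p, 'i, 'e) semi_riemannian =
  mtop :: "'p topology"
  charts :: "'i set"
  chart_dom :: "'i \<Rightarrow> 'p set"
  chart :: "'i \<Rightarrow> 'p \<Rightarrow> 'e"
  metric :: "'i \<Rightarrow> 'e local_metric"

definition chart_ran :: "('p, 'i, 'e) semi_riemannian \<Rightarrow> 'i \<Rightarrow> 'e set" where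
  "chart_ran M i = chart M i ` chart_dom M i"

definition chart_inv :: "('p, 'i, 'e) semi_riemannian \<Rightarrow> 'i \<Rightarrow> 'e \<Rightarrow> 'p" where
  "chart_inv M i = inv_into (chart_dom M i) (chart M i)"

definition transition :: "('p, 'i, 'e) semi_riemannian \<Rightarrow> 'i \<Rightarrow> 'i \<Rightarrow> 'e \<Rightarrow> 'e" where
  "transition M i j = chart M j \<circ> chart_inv M i"

definition overlap :: "('p, 'i, 'e) semi_riemannian \<Rightarrow> 'i \<Rightarrow> 'i \<Rightarrow> 'e set" where
  "overlap M i j = chart M i ` (chart_dom M i \<inter> chart_dom M j)"

definition is_smooth_manifold :: "('p, 'i, 'e::euclidean_space) semi_riemannian \<Rightarrow> bool" where
  "is_smooth_manifold M \<longleftrightarrow>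
     Hausdorff_space (mtop M) \<and> second_countable (mtop M) \<and>
     topspace (mtop M) = (\<Union>i\<in>charts M. chart_dom M i) \<and>
     (\<forall>i\<in>charts M. openin (mtop M) (chart_dom M i) \<and> open (chart_ran M i) \<and>
        homeomorphic_map (subtopology (mtop M) (chart_dom M i)) (top_of_set (chart_ran M i))
          (chart M i)) \<and>
     (\<forall>i\<in>charts M. \<forall>j\<in>charts M. smooth_on (overlap M i j) (transition M i j))"

definition form_index :: "('e::euclidean_space \<Rightarrow> 'e \<Rightarrow> real) \<Rightarrow> nat" where
  "form_index b = Max {dim W | W. subspace W \<and> (\<forall>v\<in>W. v \<noteq> 0 \<longrightarrow> b v v < 0)}"

text \<open>The last two conditions say that the local expressions are those of one tensor field on \<open>M\<close>,
  and that its index is constant.\<close>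

definition is_semi_riemannian :: "('p, 'i, 'e::euclidean_space) semi_riemannian \<Rightarrow> bool" where
  "is_semi_riemannian M \<longleftrightarrow> is_smooth_manifold M \<and>
     (\<forall>i\<in>charts M.
        (\<forall>u v. smooth_on (chart_ran M i) (\<lambda>x. metric M i x u v)) \<and>
        (\<forall>x\<in>chart_ran M i.
           bilinear (metric M i x) \<and>
           (\<forall>u v. metric M i x u v = metric M i x v u) \<and>
           (\<forall>u. (\<forall>v. metric M i x u v = 0) \<longrightarrow> u = 0))) \<and>
     (\<forall>i\<in>charts M. \<forall>j\<in>charts M. \<forall>x\<in>overlap M i j. \<forall>u v.
        metric M i x u v = metric M j (transition M i j x)
          (dir_deriv (transition M i j) x u) (dir_deriv (transition M i j) x v)) \<and>
     (\<exists>\<nu>. \<forall>i\<in>charts M. \<forall>x\<in>chart_ran M i. form_index (metric M i x) = \<nu>)"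

definition smooth_function ::
  "('p, 'i, 'e::euclidean_space) semi_riemannian \<Rightarrow> ('p \<Rightarrow> real) \<Rightarrow> bool" where
  "smooth_function M h \<longleftrightarrow> (\<forall>i\<in>charts M. smooth_on (chart_ran M i) (h \<circ> chart_inv M i))"

text \<open>The Ricci and Hessian tensors of \<open>M\<close>, as expressions in the chart \<open>i\<close>.\<close>

definition ricci ::
  "('p, 'i, 'e::euclidean_space) semi_riemannian \<Rightarrow> 'i \<Rightarrow> 'e \<Rightarrow> 'e \<Rightarrow> 'e \<Rightarrow> real" where
  "ricci M i = local_ricci (metric M i)"

definition hess ::
  "('p, 'i, 'e::euclidean_space) semi_riemannian \<Rightarrow> ('p \<Rightarrow> real) \<Rightarrow> 'i \<Rightarrow> 'e \<Rightarrow> 'e \<Rightarrow> 'e \<Rightarrow> real" where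
  "hess M h i = local_hess (metric M i) (h \<circ> chart_inv M i)"

definition ricci_flat :: "('p, 'i, 'e::euclidean_space) semi_riemannian \<Rightarrow> bool" where
  "ricci_flat M \<longleftrightarrow> (\<forall>i\<in>charts M. \<forall>x\<in>chart_ran M i. \<forall>u v. ricci M i x u v = 0)"

definition steady_gradient_ricci_soliton ::
  "('p, 'i, 'e::euclidean_space) semi_riemannian \<Rightarrow> ('p \<Rightarrow> real) \<Rightarrow> bool" where
  "steady_gradient_ricci_soliton M h \<longleftrightarrow>
     is_semi_riemannian M \<and> smooth_function M h \<and>
     (\<forall>i\<in>charts M. \<forall>x\<in>chart_ran M i. \<forall>u v. ricci M i x u v + hess M h i x u v = 0)"

text \<open>The warped product, for a positive function \<open>f\<close> on \<open>B\<close>, carries the atlas of product charts.\<close>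

definition warped_product ::
  "('p, 'i, 'd::euclidean_space) semi_riemannian \<Rightarrow> ('p \<Rightarrow> real) \<Rightarrow>
   ('q, 'j, 'e::euclidean_space) semi_riemannian \<Rightarrow>
   ('p \<times> 'q, 'i \<times> 'j, 'd \<times> 'e) semi_riemannian" where
  "warped_product B f F =
     \<lparr> mtop = prod_topology (mtop B) (mtop F),
       charts = charts B \<times> charts F,
       chart_dom = (\<lambda>(i, j). chart_dom B i \<times> chart_dom F j),
       chart = (\<lambda>(i, j) (p, q). (chart B i p, chart F j q)),
       metric = (\<lambda>(i, j) (x, y) (u, u') (v, v').
         metric B i x u v + (f (chart_inv B i x))\<^sup>2 * metric F j y u' v') \<rparr>"


section \<open>Open subsets of a Euclidean space with a given metric\<close>

definition euclidean_domain ::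
  "'e::euclidean_space set \<Rightarrow> 'e local_metric \<Rightarrow> ('e, unit, 'e) semi_riemannian" where
  "euclidean_domain U g =
     \<lparr> mtop = top_of_set U, charts = {()}, chart_dom = (\<lambda>_. U), chart = (\<lambda>_ p. p),
       metric = (\<lambda>_. g) \<rparr>"

definition pseudo_euclidean_metric :: "('n \<Rightarrow> real) \<Rightarrow> (real ^ 'n::finite) local_metric" where
  "pseudo_euclidean_metric \<epsilon> p u v = (\<Sum>i\<in>UNIV. \<Sum>j\<in>UNIV. (if i = j then \<epsilon> i else 0) * u $ i * v $ j)"

definition conformal_metric :: "('e \<Rightarrow> real) \<Rightarrow> 'e local_metric \<Rightarrow> 'e local_metric" where
  "conformal_metric \<phi> g p u v = 1 / (\<phi> p)\<^sup>2 * g p u v"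

end

(* With N^2 = m + k^2 (n - 1), the two power laws say z' = - x ((z + k)^2 - N^2) and x' = z x^2.
   All geometric data depend on the base point only through \<xi>, and log-derivatives of \<phi> and f
   are k x and x. The Christoffel symbols of the warped product are therefore explicit up to those
   of F, and each of the three blocks of Ric + Hess h (the parts along d\<xi>^2, g and g_F; the mixed
   part vanishes identically) is a polynomial in x, z, x', z', which is zero by the two equations
   above. *)

theory Submission
  imports Defs
begin

section \<open>Smooth functions\<close>

text \<open>By \<open>x' = z x^2\<close>, the function \<open>z\<close> is the quotient
  \<open>x' / x^2\<close>. Up to factors, the parts along g and g_F then impose the same condition
  on \<open>h'\<close>, solved by \<open>h' = (z + m - k (n - 2)) x\<close>. With this
  \<open>h'\<close> the part along d\<xi>^2 collapses to \<open>x^2 (N^2 - m - k^2 (n - 1))\<close>,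
  which is the origin of the square root in the power laws. Two points are not algebra. Curvature
  differentiates the Christoffel symbols, which \<open>christoffel\<close> gives only by a definite
  description: for the abstract fibre, differentiability comes from Cramer's rule; for the warped
  metric, a closed formula is checked against the Koszul formula. Moreover, a soliton must be a
  semi-Riemannian manifold with smooth potential. Constancy of the index needs additivity of the
  index under orthogonal sums, and smoothness of \<open>f\<close>, \<open>h\<close> and the
  conformal factor has to be recovered from mere differentiability through their first-order
  differential equations.\<close>

lemma frechet_derivative_cong_open:
  assumes "open S" "x \<in> S" "\<And>y. y \<in> S \<Longrightarrow> f y = g y"
  shows "frechet_derivative f (at x) = frechet_derivative g (at x)"
proof -
  have "(f has_derivative D) (at x) \<longleftrightarrow> (g has_derivative D) (at x)" for D
    using assms has_derivative_transform_within_open[of _ _ x UNIV S] by metis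
  then show ?thesis by (simp add: frechet_derivative_def)
qed

lemma dir_deriv_eq: "(F has_derivative F') (at x) \<Longrightarrow> dir_deriv F x u = F' u"
  unfolding dir_deriv_def using frechet_derivative_at by metis

lemma dir_deriv_eq_open:
  assumes "(G has_derivative F') (at x)" "open S" "x \<in> S" "\<And>y. y \<in> S \<Longrightarrow> F y = G y"
  shows "dir_deriv F x u = F' u"
  using frechet_derivative_cong_open[OF assms(2,3), of F G] assms(1,4) dir_deriv_eq[of G F' x]
  by (simp add: dir_deriv_def)

text \<open>Transition maps and local expressions are built from \<open>inv_into\<close> and agree
  with their smooth formulas only on a chart range. Openness of \<open>S\<close> carries the
  agreement over to derivatives at points of \<open>S\<close>, so the induction continues.\<close>

lemma Ck_on_cong:
  assumes "open S" "\<And>x. x \<in> S \<Longrightarrow> f x = g x"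
  shows "Ck_on k S f \<longleftrightarrow> Ck_on k S g"
  using assms(2)
proof (induction k arbitrary: f g)
  case 0
  then show ?case by (simp cong: continuous_on_cong)
next
  case (Suc k)
  have "f differentiable (at x) \<longleftrightarrow> g differentiable (at x)" if "x \<in> S" for x
    using Suc.prems assms(1) that has_derivative_transform_within_open[of _ _ x UNIV S]
    unfolding differentiable_def by metis
  moreover have "Ck_on k S (\<lambda>x. frechet_derivative f (at x) v)
      \<longleftrightarrow> Ck_on k S (\<lambda>x. frechet_derivative g (at x) v)" for v
    using frechet_derivative_cong_open[OF assms(1) _ Suc.prems]
    by (intro Suc.IH) auto
  ultimately show ?case by auto
qed

lemma Ck_on_SucD: "Ck_on (Suc k) S f \<Longrightarrow> Ck_on k S f"
proof (induction k arbitrary: f)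
  case 0
  then show ?case
    by (auto intro!: continuous_at_imp_continuous_on differentiable_imp_continuous_within)
next
  case (Suc k)
  then show ?case by (metis Ck_on.simps(2))
qed

text \<open>Entry point of the regularity proofs below: an explicit derivative may replace the one
  selected by \<open>frechet_derivative\<close>.\<close>

lemma Ck_on_SucI:
  assumes "open S" "\<And>x. x \<in> S \<Longrightarrow> (f has_derivative f' x) (at x)"
    and "\<And>v. Ck_on k S (\<lambda>x. f' x v)"
  shows "Ck_on (Suc k) S f"
proof -
  have "Ck_on k S (\<lambda>x. frechet_derivative f (at x) v) \<longleftrightarrow> Ck_on k S (\<lambda>x. f' x v)" for v
    using assms(2) frechet_derivative_at[of f] by (intro Ck_on_cong[OF assms(1)]) metis
  then show ?thesis using assms(2,3) by (auto simp: differentiable_def)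
qed

lemma Ck_on_has_derivative:
  "Ck_on (Suc k) S f \<Longrightarrow> x \<in> S \<Longrightarrow> (f has_derivative frechet_derivative f (at x)) (at x)"
  by (simp flip: frechet_derivative_works)

lemma Ck_on_add:
  assumes "open S" "Ck_on k S f" "Ck_on k S g"
  shows "Ck_on k S (\<lambda>x. f x + g x)"
  using assms(2,3)
proof (induction k arbitrary: f g)
  case 0
  then show ?case by (simp add: continuous_on_add)
next
  case (Suc k)
  show ?case
  proof (rule Ck_on_SucI[OF assms(1)])
    fix x assume "x \<in> S"
    then show "((\<lambda>x. f x + g x) has_derivative
        (\<lambda>v. frechet_derivative f (at x) v + frechet_derivative g (at x) v)) (at x)"
      using Suc.prems by (intro has_derivative_add Ck_on_has_derivative)
  next
    fix v show "Ck_on k S (\<lambda>x. frechet_derivative f (at x) v + frechet_derivative g (at x) v)"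
      using Suc by simp
  qed
qed

lemma Ck_on_linear:
  assumes "bounded_linear L" "open S" "Ck_on k S f"
  shows "Ck_on k S (\<lambda>x. L (f x))"
  using assms(3)
proof (induction k arbitrary: f)
  case 0
  then show ?case using assms(1) by (simp add: bounded_linear.continuous_on)
next
  case (Suc k)
  show ?case
  proof (rule Ck_on_SucI[OF assms(2)])
    fix x assume "x \<in> S"
    then show "((\<lambda>x. L (f x)) has_derivative (\<lambda>v. L (frechet_derivative f (at x) v))) (at x)"
      using Suc.prems by (intro bounded_linear.has_derivative[OF assms(1)] Ck_on_has_derivative)
  next
    fix v show "Ck_on k S (\<lambda>x. L (frechet_derivative f (at x) v))"
      using Suc by simp
  qed
qed

lemma (in bounded_bilinear) Ck_on:
  assumes "open S" "Ck_on k S f" "Ck_on k S g"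
  shows "Ck_on k S (\<lambda>x. prod (f x) (g x))"
  using assms(2,3)
proof (induction k arbitrary: f g)
  case 0
  then show ?case by (simp add: continuous_on)
next
  case (Suc k)
  show ?case
  proof (rule Ck_on_SucI[OF assms(1)])
    fix x assume "x \<in> S"
    then show "((\<lambda>x. prod (f x) (g x)) has_derivative
        (\<lambda>v. prod (f x) (frechet_derivative g (at x) v)
           + prod (frechet_derivative f (at x) v) (g x))) (at x)"
      using Suc.prems by (intro FDERIV Ck_on_has_derivative)
  next
    fix v
    show "Ck_on k S (\<lambda>x. prod (f x) (frechet_derivative g (at x) v)
        + prod (frechet_derivative f (at x) v) (g x))"
      \<comment> \<open>Each Leibniz term contains an undifferentiated factor of class
        \<open>k + 1\<close>, lowered here to class \<open>k\<close> for the induction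
        hypothesis.\<close>
      using Suc.prems Suc.prems[THEN Ck_on_SucD] by (intro Ck_on_add assms(1) Suc.IH) auto
  qed
qed

text \<open>The derivative of the composite in direction \<open>v\<close> is the derivative of
  \<open>f\<close> in the fixed direction \<open>L v\<close>, again composed with \<open>L\<close>,
  so the induction closes without a general chain rule. The maps composed with later are
  \<open>fst\<close>, \<open>snd\<close> and \<open>\<xi>\<close>.\<close>

lemma Ck_on_compose_linear:
  assumes "bounded_linear L" "open S" "L ` S \<subseteq> T" "Ck_on k T f"
  shows "Ck_on k S (\<lambda>x. f (L x))"
  using assms(4)
proof (induction k arbitrary: f)
  case 0
  then show ?case using assms(1,3)
    by (auto intro!: continuous_on_compose2[of T f] bounded_linear.continuous_on[OF assms(1)])
next
  case (Suc k)
  show ?case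
  proof (rule Ck_on_SucI[OF assms(2)])
    fix x assume "x \<in> S"
    then show "((\<lambda>x. f (L x)) has_derivative (\<lambda>v. frechet_derivative f (at (L x)) (L v))) (at x)"
      using Suc.prems assms(3)
      by (intro has_derivative_compose[OF bounded_linear_imp_has_derivative[OF assms(1)]]
          Ck_on_has_derivative) auto
  next
    fix v show "Ck_on k S (\<lambda>x. frechet_derivative f (at (L x)) (L v))"
      using Suc by (intro Suc.IH) simp
  qed
qed

lemma Ck_on_const: "open S \<Longrightarrow> Ck_on k S (\<lambda>_. c)"
proof (induction k arbitrary: c)
  case (Suc k)
  then show ?case by (intro Ck_on_SucI[where f' = "\<lambda>_ _. 0"]) auto
qed simp

lemma smooth_on_cong:
  "open S \<Longrightarrow> (\<And>x. x \<in> S \<Longrightarrow> f x = g x) \<Longrightarrow> smooth_on S f \<longleftrightarrow> smooth_on S g"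
  unfolding smooth_on_def by (intro iff_allI Ck_on_cong)

lemma smooth_on_add:
  "open S \<Longrightarrow> smooth_on S f \<Longrightarrow> smooth_on S g \<Longrightarrow> smooth_on S (\<lambda>x. f x + g x)"
  by (simp add: smooth_on_def Ck_on_add)

lemma smooth_on_linear:
  "bounded_linear L \<Longrightarrow> open S \<Longrightarrow> smooth_on S f \<Longrightarrow> smooth_on S (\<lambda>x. L (f x))"
  by (simp add: smooth_on_def Ck_on_linear)

lemma smooth_on_mult:
  fixes f g :: "'a::euclidean_space \<Rightarrow> 'b::real_normed_algebra"
  shows "open S \<Longrightarrow> smooth_on S f \<Longrightarrow> smooth_on S g \<Longrightarrow> smooth_on S (\<lambda>x. f x * g x)"
  by (simp add: smooth_on_def bounded_bilinear.Ck_on[OF bounded_bilinear_mult])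

lemma smooth_on_compose_linear:
  "bounded_linear L \<Longrightarrow> open S \<Longrightarrow> L ` S \<subseteq> T \<Longrightarrow> smooth_on T f \<Longrightarrow> smooth_on S (\<lambda>x. f (L x))"
  by (simp add: smooth_on_def Ck_on_compose_linear)

lemma smooth_on_const: "open S \<Longrightarrow> smooth_on S (\<lambda>_. c)"
  by (simp add: smooth_on_def Ck_on_const)

lemma smooth_on_id: "open S \<Longrightarrow> smooth_on S (\<lambda>x. x)"
  unfolding smooth_on_def
proof
  fix k assume "open S"
  then show "Ck_on k S (\<lambda>x. x)"
    by (cases k) (simp, simp only:, intro Ck_on_SucI[where f' = "\<lambda>_ v. v"] Ck_on_const has_derivative_ident)
qed

lemma smooth_on_has_derivative:
  "smooth_on S f \<Longrightarrow> x \<in> S \<Longrightarrow> (f has_derivative dir_deriv f x) (at x)"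
  unfolding smooth_on_def dir_deriv_def[abs_def] by (rule Ck_on_has_derivative) auto

lemma smooth_on_dir_deriv: "smooth_on S f \<Longrightarrow> smooth_on S (\<lambda>x. dir_deriv f x v)"
  unfolding smooth_on_def dir_deriv_def by (metis Ck_on.simps(2))

section \<open>Functions of one real variable: smoothness from differential equations\<close>

lemma Ck_on_real_SucI:
  fixes f :: "real \<Rightarrow> real"
  assumes "open S" "\<And>t. t \<in> S \<Longrightarrow> (f has_real_derivative f' t) (at t)" "Ck_on k S f'"
  shows "Ck_on (Suc k) S f"
proof (rule Ck_on_SucI[OF assms(1)])
  show "(f has_derivative (\<lambda>v. f' t * v)) (at t)" if "t \<in> S" for t
    using assms(2)[OF that] by (simp add: has_field_derivative_def)
  show "Ck_on k S (\<lambda>t. f' t * v)" for v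
    by (rule Ck_on_linear[OF bounded_linear_mult_left assms(1,3)])
qed

lemma smooth_on_antiderivative:
  fixes f :: "real \<Rightarrow> real"
  assumes "open S" "\<And>t. t \<in> S \<Longrightarrow> (f has_real_derivative f' t) (at t)" "smooth_on S f'"
  shows "smooth_on S f"
  unfolding smooth_on_def
proof
  fix k
  have "Ck_on (Suc k) S f"
    using assms(3) by (intro Ck_on_real_SucI[OF assms(1,2)]) (auto simp: smooth_on_def)
  then show "Ck_on k S f" by (rule Ck_on_SucD)
qed

text \<open>Bootstrapping: if \<open>f\<close> is of class \<open>k\<close>, so is its derivative
  \<open>c * f\<close>, hence \<open>f\<close> is of class \<open>k + 1\<close>.\<close>

lemma smooth_on_linear_ode:
  fixes f c :: "real \<Rightarrow> real"
  assumes "open S" "\<And>t. t \<in> S \<Longrightarrow> (f has_real_derivative c t * f t) (at t)" "smooth_on S c"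
  shows "smooth_on S f"
  unfolding smooth_on_def
proof
  fix k show "Ck_on k S f"
  proof (induction k)
    case 0
    then show ?case
      using assms(2) by (auto intro!: continuous_at_imp_continuous_on DERIV_isCont)
  next
    case (Suc k)
    have "Ck_on k S (\<lambda>t. c t * f t)"
      using assms(3) Suc
      by (intro bounded_bilinear.Ck_on[OF bounded_bilinear_mult assms(1)]) (auto simp: smooth_on_def)
    then show ?case using Ck_on_real_SucI[OF assms(1,2)] by simp
  qed
qed

section \<open>Warped products of semi-Riemannian manifolds\<close>

lemma form_index_eqI:
  fixes b :: "'e::euclidean_space \<Rightarrow> 'e \<Rightarrow> real"
  assumes "subspace W" "\<And>v. v \<in> W \<Longrightarrow> v \<noteq> 0 \<Longrightarrow> b v v < 0"
    and "subspace P" "\<And>v. v \<in> P \<Longrightarrow> b v v \<ge> 0"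
    and "dim W + dim P \<ge> DIM('e)"
  shows "form_index b = dim W"
  unfolding form_index_def
proof (rule Max_eqI)
  show "finite {dim W | W. subspace W \<and> (\<forall>v\<in>W. v \<noteq> 0 \<longrightarrow> b v v < 0)}"
    by (rule finite_subset[of _ "{..DIM('e)}"]) (auto simp: dim_subset_UNIV)
  show "dim W \<in> {dim W | W. subspace W \<and> (\<forall>v\<in>W. v \<noteq> 0 \<longrightarrow> b v v < 0)}"
    using assms by blast
next
  fix d assume "d \<in> {dim W | W. subspace W \<and> (\<forall>v\<in>W. v \<noteq> 0 \<longrightarrow> b v v < 0)}"
  then obtain V where V: "d = dim V" "subspace V" "\<And>v. v \<in> V \<Longrightarrow> v \<noteq> 0 \<Longrightarrow> b v v < 0"
    by blast
  \<comment> \<open>A negative definite subspace meets the nonnegative \<open>P\<close> only in 0,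
    so its dimension is at most the codimension of \<open>P\<close>, hence at most
    \<open>dim W\<close>.\<close>
  have "V \<inter> P \<subseteq> {0}" using V(3) assms(4) by force
  then have "dim (V \<inter> P) = 0" by simp
  then have "dim V + dim P = dim {x + y |x y. x \<in> V \<and> y \<in> P}"
    using dim_sums_Int[OF V(2) assms(3)] by linarith
  also have "\<dots> \<le> DIM('e)" by (rule dim_subset_UNIV)
  finally show "d \<le> dim W" using V(1) assms(5) by simp
qed

text \<open>A negative definite subspace \<open>W\<close> of maximal dimension has a nonnegative orthogonal complement,
  since a negative vector in it would enlarge \<open>W\<close>.\<close>

lemma form_index_cases:
  fixes b :: "'e::euclidean_space \<Rightarrow> 'e \<Rightarrow> real"
  assumes "bilinear b" "\<And>u v. b u v = b v u"
  obtains W P where "subspace W" "\<And>v. v \<in> W \<Longrightarrow> v \<noteq> 0 \<Longrightarrow> b v v < 0"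
    and "subspace P" "\<And>v. v \<in> P \<Longrightarrow> b v v \<ge> 0"
    and "dim W + dim P \<ge> DIM('e)" "form_index b = dim W"
proof -
  let ?D = "{dim W | W. subspace W \<and> (\<forall>v\<in>W. v \<noteq> 0 \<longrightarrow> b v v < 0)}"
  have fin: "finite ?D"
    by (rule finite_subset[of _ "{..DIM('e)}"]) (auto simp: dim_subset_UNIV)
  have "dim {0::'e} \<in> ?D" by (auto intro!: exI[of _ "{0}"])
  then have "Max ?D \<in> ?D" using fin by (intro Max_in) auto
  then obtain W where W: "Max ?D = dim W" "subspace W" "\<And>v. v \<in> W \<Longrightarrow> v \<noteq> 0 \<Longrightarrow> b v v < 0"
    by blast
  note lin = bilinear_ladd[OF assms(1)] bilinear_radd[OF assms(1)] bilinear_lmul[OF assms(1)]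
    bilinear_rmul[OF assms(1)] bilinear_lzero[OF assms(1)] bilinear_rzero[OF assms(1)]
  define P where "P = {v. \<forall>w\<in>W. b v w = 0}"
  have subP: "subspace P"
    by (auto simp: P_def subspace_def lin)
  have nonneg: "b v v \<ge> 0" if v: "v \<in> P" for v
  proof (rule ccontr)
    assume neg: "\<not> b v v \<ge> 0"
    then have "v \<notin> W" using v by (auto simp: P_def)
    let ?W = "{x + y |x y. x \<in> W \<and> y \<in> span {v}}"
    have "b u u < 0" if u0: "u \<in> ?W" "u \<noteq> 0" for u
    proof -
      obtain w c where u: "u = w + c *\<^sub>R v" "w \<in> W"
        using u0(1) unfolding span_singleton by blast
      have "b v w = 0" "b w v = 0" using v u(2) assms(2) by (auto simp: P_def)
      then have "b u u = b w w + c * (c * b v v)" unfolding u(1) by (simp add: lin)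
      moreover have "c * (c * b v v) \<le> 0"
        using neg by (simp add: mult_nonneg_nonpos flip: mult.assoc)
      moreover have "b w w \<le> 0" using W(3)[OF u(2)] by (cases "w = 0") (auto simp: lin)
      moreover have "w \<noteq> 0 \<or> c \<noteq> 0" using u0(2) u(1) by auto
      moreover have "c * (c * b v v) < 0" if "c \<noteq> 0"
        using neg that mult_pos_neg[of "c\<^sup>2" "b v v"]
        by (simp add: power2_eq_square mult.assoc not_le del: zero_less_power2)
          (metis not_real_square_gt_zero)
      ultimately show ?thesis using W(3)[OF u(2)] by fastforce
    qed
    moreover have "subspace ?W" using W(2) by (intro subspace_sums) auto
    ultimately have "dim ?W \<in> ?D" by blast
    then have "dim ?W \<le> dim W" unfolding W(1)[symmetric] by (rule Max_ge[OF fin])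
    moreover have "W \<inter> span {v} \<subseteq> {0}"
    proof
      fix u assume "u \<in> W \<inter> span {v}"
      then obtain c where "c *\<^sub>R v \<in> W" "u = c *\<^sub>R v" by (auto simp: span_singleton)
      then show "u \<in> {0}"
        using \<open>v \<notin> W\<close> subspace_scale[OF W(2), of "c *\<^sub>R v" "inverse c"] by (cases "c = 0") auto
    qed
    then have "dim (W \<inter> span {v}) = 0" by simp
    moreover have "v \<noteq> 0" using neg by (auto simp: lin)
    ultimately show False using dim_sums_Int[OF W(2), of "span {v}"]
      by (simp del: dim_eq_0 add: dim_singleton)
  qed
  \<comment> \<open>\<open>L\<close> expresses \<open>b\<close> through the Euclidean inner product,
    so that \<open>P\<close> is the Euclidean orthogonal complement of the image of \<open>W\<close>
    under \<open>L\<close>. That image has dimension at most \<open>dim W\<close>, so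
    \<open>P\<close> has at least the complementary dimension.\<close>
  define L where "L w = (\<Sum>e\<in>Basis. b e w *\<^sub>R e)" for w
  have "linear L"
    by (rule linearI) (simp_all add: L_def lin scaleR_add_left sum.distrib scaleR_sum_right)
  have L: "b v w = v \<bullet> L w" for v w
  proof -
    have "linear (\<lambda>v. b v w)" using assms(1) by (simp add: bilinear_def)
    then have "b (\<Sum>e\<in>Basis. (v \<bullet> e) *\<^sub>R e) w = (\<Sum>e\<in>Basis. (v \<bullet> e) * b e w)"
      using linear_sum[of "\<lambda>v. b v w" "\<lambda>e. (v \<bullet> e) *\<^sub>R e" Basis] by (simp add: lin)
    then show ?thesis by (simp add: L_def inner_sum_right euclidean_representation mult.commute)
  qed
  have "P = {y \<in> UNIV. \<forall>x \<in> L ` W. orthogonal x y}"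
    by (auto simp: P_def L orthogonal_def inner_commute)
  then have "dim P + dim (L ` W) = DIM('e)"
    using dim_subspace_orthogonal_to_vectors[of "L ` W" UNIV] \<open>linear L\<close> W(2)
    by (simp add: linear_subspace_image)
  moreover have "dim (L ` W) \<le> dim W" using \<open>linear L\<close> by (rule dim_image_le)
  ultimately have "dim W + dim P \<ge> DIM('e)" by simp
  then show thesis
    by (intro that[OF W(2,3) subP nonneg]) (simp_all add: form_index_def W(1))
qed

lemma form_index_scale:
  "c > 0 \<Longrightarrow> form_index (\<lambda>u v. c * b u v) = form_index b"
  by (simp add: form_index_def mult_less_0_iff)

text \<open>Products of the two pairs supplied by \<open>form_index_cases\<close> form such a pair
  for the orthogonal sum, since dimensions add and the factor \<open>c > 0\<close> changes no
  sign.\<close>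

lemma form_index_prod:
  fixes b :: "'d::euclidean_space \<Rightarrow> 'd \<Rightarrow> real" and b' :: "'e::euclidean_space \<Rightarrow> 'e \<Rightarrow> real"
  assumes "bilinear b" "\<And>u v. b u v = b v u" "bilinear b'" "\<And>u v. b' u v = b' v u" "c > 0"
  shows "form_index (\<lambda>(u, u') (v, v'). b u v + c * b' u' v') = form_index b + form_index b'"
proof -
  obtain W P where 1: "subspace W" "\<And>v. v \<in> W \<Longrightarrow> v \<noteq> 0 \<Longrightarrow> b v v < 0"
    "subspace P" "\<And>v. v \<in> P \<Longrightarrow> b v v \<ge> 0"
    "dim W + dim P \<ge> DIM('d)" "form_index b = dim W"
    using form_index_cases[OF assms(1,2)] by blast
  obtain W' P' where 2: "subspace W'" "\<And>v. v \<in> W' \<Longrightarrow> v \<noteq> 0 \<Longrightarrow> b' v v < 0"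
    "subspace P'" "\<And>v. v \<in> P' \<Longrightarrow> b' v v \<ge> 0"
    "dim W' + dim P' \<ge> DIM('e)" "form_index b' = dim W'"
    using form_index_cases[OF assms(3,4)] by blast
  have 0: "b 0 0 = 0" "b' 0 0 = 0"
    using bilinear_lzero[OF assms(1)] bilinear_lzero[OF assms(3)] by auto
  have "form_index (\<lambda>(u, u') (v, v'). b u v + c * b' u' v') = dim (W \<times> W')"
  proof (rule form_index_eqI[where P = "P \<times> P'"])
    show "subspace (W \<times> W')" "subspace (P \<times> P')" using 1 2 by (simp_all add: subspace_Times)
    show "dim (W \<times> W') + dim (P \<times> P') \<ge> DIM('d \<times> 'e)"
      using 1 2 by (simp add: dim_Times)
  next
    fix v assume "v \<in> P \<times> P'"
    then show "(case v of (u, u') \<Rightarrow> \<lambda>(v, v'). b u v + c * b' u' v') v \<ge> 0"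
      using 1(4) 2(4) assms(5) by (auto split: prod.splits)
  next
    fix v :: "'d \<times> 'e" assume v: "v \<in> W \<times> W'" "v \<noteq> 0"
    obtain u u' where u: "v = (u, u')" by force
    have "b u u \<le> 0" "b' u' u' \<le> 0"
      using v 1(2)[of u] 2(2)[of u'] 0 by (cases "u = 0"; cases "u' = 0"; auto simp: u)+
    then have "b u u \<le> 0" "c * b' u' u' \<le> 0" using assms(5) by (simp_all add: mult_nonneg_nonpos)
    moreover have "b u u < 0 \<or> c * b' u' u' < 0"
      using v 1(2)[of u] 2(2)[of u'] assms(5) by (auto simp: u mult_less_0_iff zero_prod_def)
    ultimately show "(case v of (u, u') \<Rightarrow> \<lambda>(v, v'). b u v + c * b' u' v') v < 0"
      by (auto simp: u)
  qed
  then show ?thesis using 1 2 by (simp add: dim_Times)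
qed

section \<open>Products of topological spaces\<close>

lemma second_countable_prod_topology:
  assumes "second_countable X" "second_countable Y"
  shows "second_countable (prod_topology X Y)"
proof -
  obtain A where A: "countable A" "\<And>V. V \<in> A \<Longrightarrow> openin X V"
    "\<And>U x. openin X U \<Longrightarrow> x \<in> U \<Longrightarrow> \<exists>V\<in>A. x \<in> V \<and> V \<subseteq> U"
    using assms(1) unfolding second_countable_def by metis
  obtain B where B: "countable B" "\<And>V. V \<in> B \<Longrightarrow> openin Y V"
    "\<And>U x. openin Y U \<Longrightarrow> x \<in> U \<Longrightarrow> \<exists>V\<in>B. x \<in> V \<and> V \<subseteq> U"
    using assms(2) unfolding second_countable_def by metis
  show ?thesis unfolding second_countable_def
  proof (intro exI conjI allI impI ballI)
    show "countable ((\<lambda>(U, V). U \<times> V) ` (A \<times> B))" using A(1) B(1) by simp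
  next
    fix V assume "V \<in> (\<lambda>(U, V). U \<times> V) ` (A \<times> B)"
    then show "openin (prod_topology X Y) V" using A(2) B(2) by (auto simp: openin_prod_Times_iff)
  next
    fix U xy assume U: "openin (prod_topology X Y) U \<and> xy \<in> U"
    obtain x y where xy: "xy = (x, y)" by force
    then obtain U1 U2 where "openin X U1" "openin Y U2" "x \<in> U1" "y \<in> U2" "U1 \<times> U2 \<subseteq> U"
      using U unfolding openin_prod_topology_alt by blast
    moreover obtain V1 where "V1 \<in> A" "x \<in> V1" "V1 \<subseteq> U1" using A(3) calculation by metis
    moreover obtain V2 where "V2 \<in> B" "y \<in> V2" "V2 \<subseteq> U2" using B(3) calculation by metis
    ultimately show "\<exists>V\<in>(\<lambda>(U, V). U \<times> V) ` (A \<times> B). xy \<in> V \<and> V \<subseteq> U"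
      unfolding xy by (intro bexI[of _ "V1 \<times> V2"]) auto
  qed
qed

lemma homeomorphic_map_prod:
  assumes "homeomorphic_map X X' f" "homeomorphic_map Y Y' g"
  shows "homeomorphic_map (prod_topology X Y) (prod_topology X' Y') (\<lambda>(x, y). (f x, g y))"
proof -
  obtain f' g' where "homeomorphic_maps X X' f f'" "homeomorphic_maps Y Y' g g'"
    using assms by (auto simp: homeomorphic_map_maps)
  then show ?thesis unfolding homeomorphic_map_maps using homeomorphic_maps_prod by blast
qed

section \<open>Charts, overlaps and transition maps\<close>

lemma chart_homeomorphic:
  assumes "is_smooth_manifold M" "i \<in> charts M"
  shows "openin (mtop M) (chart_dom M i)" "open (chart_ran M i)"
    and "homeomorphic_map (subtopology (mtop M) (chart_dom M i)) (top_of_set (chart_ran M i))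
          (chart M i)"
    and "chart_dom M i \<subseteq> topspace (mtop M)"
  using assms openin_subset unfolding is_smooth_manifold_def by blast+

lemma chart_inj_on:
  assumes "is_smooth_manifold M" "i \<in> charts M"
  shows "inj_on (chart M i) (chart_dom M i)"
  using homeomorphic_imp_injective_map[OF chart_homeomorphic(3)[OF assms]]
    chart_homeomorphic(4)[OF assms] by (simp add: Int_absorb1)

lemma chart_inv_chart:
  assumes "is_smooth_manifold M" "i \<in> charts M" "p \<in> chart_dom M i"
  shows "chart_inv M i (chart M i p) = p"
  using chart_inj_on[OF assms(1,2)] assms(3) by (simp add: chart_inv_def)

lemma overlap_subset: "overlap M i j \<subseteq> chart_ran M i"
  by (auto simp: overlap_def chart_ran_def)

lemma open_overlap:
  assumes "is_smooth_manifold M" "i \<in> charts M" "j \<in> charts M"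
  shows "open (overlap M i j)"
proof -
  have "openin (subtopology (mtop M) (chart_dom M i)) (chart_dom M i \<inter> chart_dom M j)"
    using chart_homeomorphic(1)[OF assms(1,3)] by (rule openin_subtopology_Int2)
  then have "openin (top_of_set (chart_ran M i)) (overlap M i j)"
    unfolding overlap_def
    using homeomorphic_imp_open_map[OF chart_homeomorphic(3)[OF assms(1,2)]]
    by (auto simp: open_map_def)
  then show ?thesis
    using chart_homeomorphic(2)[OF assms(1,2)] openin_open_eq by blast
qed

lemma smooth_transition:
  assumes "is_smooth_manifold M" "i \<in> charts M" "j \<in> charts M"
  shows "smooth_on (overlap M i j) (transition M i j)"
  using assms unfolding is_smooth_manifold_def by blast

lemma has_derivative_pair_maps:
  assumes "(f has_derivative f') (at x)" "(g has_derivative g') (at y)"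
  shows "((\<lambda>z. (f (fst z), g (snd z))) has_derivative (\<lambda>d. (f' (fst d), g' (snd d)))) (at (x, y))"
proof (rule has_derivative_Pair)
  show "((\<lambda>z. f (fst z)) has_derivative (\<lambda>d. f' (fst d))) (at (x, y))"
    using assms(1) by (intro has_derivative_compose[OF bounded_linear_imp_has_derivative[OF bounded_linear_fst]]) simp
  show "((\<lambda>z. g (snd z)) has_derivative (\<lambda>d. g' (snd d))) (at (x, y))"
    using assms(2) by (intro has_derivative_compose[OF bounded_linear_imp_has_derivative[OF bounded_linear_snd]]) simp
qed

section \<open>The warped product as a semi-Riemannian manifold\<close>

context
  fixes B :: "('p, 'i, 'd::euclidean_space) semi_riemannian" and f :: "'p \<Rightarrow> real"
    and F :: "('q, 'j, 'e::euclidean_space) semi_riemannian"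
begin

lemma warped_simps:
  "mtop (warped_product B f F) = prod_topology (mtop B) (mtop F)"
  "charts (warped_product B f F) = charts B \<times> charts F"
  "chart_dom (warped_product B f F) (i, j) = chart_dom B i \<times> chart_dom F j"
  "chart (warped_product B f F) (i, j) = (\<lambda>(p, q). (chart B i p, chart F j q))"
  "metric (warped_product B f F) (i, j) = (\<lambda>(x, y) (u, u') (v, v').
         metric B i x u v + (f (chart_inv B i x))\<^sup>2 * metric F j y u' v')"
  by (simp_all add: warped_product_def fun_eq_iff)

lemma warped_chart_ran:
  "chart_ran (warped_product B f F) (i, j) = chart_ran B i \<times> chart_ran F j"
  by (force simp: chart_ran_def warped_simps)

lemma warped_overlap:
  "overlap (warped_product B f F) (i, j) (i', j') = overlap B i i' \<times> overlap F j j'"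
  by (force simp: overlap_def warped_simps)

lemma warped_chart_inv:
  assumes "is_smooth_manifold B" "i \<in> charts B" "is_smooth_manifold F" "j \<in> charts F"
    and "x \<in> chart_ran B i" "y \<in> chart_ran F j"
  shows "chart_inv (warped_product B f F) (i, j) (x, y) = (chart_inv B i x, chart_inv F j y)"
proof -
  obtain p q where pq: "x = chart B i p" "p \<in> chart_dom B i" "y = chart F j q" "q \<in> chart_dom F j"
    using assms(5,6) by (auto simp: chart_ran_def)
  have "inj_on (\<lambda>(p, q). (chart B i p, chart F j q)) (chart_dom B i \<times> chart_dom F j)"
    using chart_inj_on[OF assms(1,2)] chart_inj_on[OF assms(3,4)] by (auto simp: inj_on_def)
  then show ?thesis
    using chart_inv_chart[OF assms(1,2) pq(2)] chart_inv_chart[OF assms(3,4) pq(4)] pq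
    unfolding chart_inv_def[of "warped_product B f F"] warped_simps
    by (intro inv_into_f_eq) auto
qed

lemma warped_transition:
  assumes "is_smooth_manifold B" "i \<in> charts B" "is_smooth_manifold F" "j \<in> charts F"
    and "x \<in> chart_ran B i" "y \<in> chart_ran F j"
  shows "transition (warped_product B f F) (i, j) (i', j') (x, y)
    = (transition B i i' x, transition F j j' y)"
  by (simp add: transition_def warped_chart_inv[OF assms] warped_simps)

lemma is_smooth_manifold_warped_product:
  assumes "is_smooth_manifold B" "is_smooth_manifold F"
  shows "is_smooth_manifold (warped_product B f F)"
  unfolding is_smooth_manifold_def
proof (intro conjI ballI)
  let ?W = "warped_product B f F"
  show "Hausdorff_space (mtop ?W)" "second_countable (mtop ?W)"
    using assms by (auto simp: is_smooth_manifold_def warped_simps Hausdorff_space_prod_topology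
        intro: second_countable_prod_topology)
  show "topspace (mtop ?W) = (\<Union>i\<in>charts ?W. chart_dom ?W i)"
  proof -
    have "topspace (mtop B) = (\<Union>i\<in>charts B. chart_dom B i)"
      "topspace (mtop F) = (\<Union>i\<in>charts F. chart_dom F i)"
      using assms by (auto simp: is_smooth_manifold_def)
    then show ?thesis by (auto simp: warped_simps)
  qed
next
  fix c assume c: "c \<in> charts (warped_product B f F)"
  obtain i j where ij: "c = (i, j)" "i \<in> charts B" "j \<in> charts F"
    using c by (auto simp: warped_simps)
  note B = chart_homeomorphic[OF assms(1) ij(2)] and F = chart_homeomorphic[OF assms(2) ij(3)]
  show "openin (mtop (warped_product B f F)) (chart_dom (warped_product B f F) c)"
    using B(1) F(1) by (simp add: ij(1) warped_simps openin_prod_Times_iff)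
  show "open (chart_ran (warped_product B f F) c)"
    using B(2) F(2) by (simp add: ij(1) warped_chart_ran open_Times)
  show "homeomorphic_map
      (subtopology (mtop (warped_product B f F)) (chart_dom (warped_product B f F) c))
      (top_of_set (chart_ran (warped_product B f F) c)) (chart (warped_product B f F) c)"
    using homeomorphic_map_prod[OF B(3) F(3)]
    unfolding ij(1) warped_simps warped_chart_ran subtopology_Times prod_topology_subtopology_eu .
  fix c' assume c': "c' \<in> charts (warped_product B f F)"
  obtain i' j' where ij': "c' = (i', j')" "i' \<in> charts B" "j' \<in> charts F"
    using c' by (auto simp: warped_simps)
  have op: "open (overlap B i i' \<times> overlap F j j')"
    using open_overlap assms ij ij' by (metis open_Times)
  have bl: "bounded_linear (\<lambda>x::'d. (x, 0::'e))" "bounded_linear (\<lambda>y::'e. (0::'d, y))"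
    by (auto intro: bounded_linear_intros)
  \<comment> \<open>The pair of transition maps is written as a sum of images under the linear
    embeddings of the two factors, so closure under sums and linear maps suffices.\<close>
  have s1: "smooth_on (overlap B i i' \<times> overlap F j j')
      (\<lambda>z. (transition B i i' (fst z), 0) + (0, transition F j j' (snd z)))"
    by (rule smooth_on_add[OF op
          smooth_on_linear[OF bl(1) op smooth_on_compose_linear[OF bounded_linear_fst op _
            smooth_transition[OF assms(1) ij(2) ij'(2)]]]
          smooth_on_linear[OF bl(2) op smooth_on_compose_linear[OF bounded_linear_snd op _
            smooth_transition[OF assms(2) ij(3) ij'(3)]]]]) auto
  have s2: "transition (warped_product B f F) c c' z
      = (transition B i i' (fst z), 0) + (0, transition F j j' (snd z))"
    if "z \<in> overlap B i i' \<times> overlap F j j'" for z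
    using that warped_transition[OF assms(1) ij(2) assms(2) ij(3), of "fst z" "snd z"]
      subsetD[OF overlap_subset, of "fst z" B i i'] subsetD[OF overlap_subset, of "snd z" F j j']
      by (auto simp: ij ij')
  have "smooth_on (overlap B i i' \<times> overlap F j j') (transition (warped_product B f F) c c')"
    by (rule iffD2[OF smooth_on_cong[OF op s2] s1])
  then show "smooth_on (overlap (warped_product B f F) c c')
      (transition (warped_product B f F) c c')"
    by (simp add: ij ij' warped_overlap)
qed


text \<open>Positivity of \<open>f\<close> preserves nondegeneracy in the fibre directions and makes
  the index the sum of the two constant indices.\<close>

lemma is_semi_riemannian_warped_product:
  assumes B: "is_semi_riemannian B" and F: "is_semi_riemannian F"
    and f: "smooth_function B f" "\<And>p. p \<in> topspace (mtop B) \<Longrightarrow> f p > 0"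
  shows "is_semi_riemannian (warped_product B f F)"
  unfolding is_semi_riemannian_def
proof (intro conjI ballI allI)
  have mB: "is_smooth_manifold B" and mF: "is_smooth_manifold F"
    using B F by (auto simp: is_semi_riemannian_def)
  then show "is_smooth_manifold (warped_product B f F)"
    by (rule is_smooth_manifold_warped_product)
  have fpos: "f (chart_inv B i x) > 0" if i: "i \<in> charts B" "x \<in> chart_ran B i" for i x
  proof -
    obtain p where p: "x = chart B i p" "p \<in> chart_dom B i"
      using i(2) by (auto simp: chart_ran_def)
    then show ?thesis
      using chart_inv_chart[OF mB i(1) p(2)] chart_homeomorphic(4)[OF mB i(1)] f(2)[of p]
      by auto
  qed
  have bilB: "bilinear (metric B i x)" "metric B i x u v = metric B i x v u"
      "(\<forall>v. metric B i x u v = 0) \<longrightarrow> u = 0"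
    if "i \<in> charts B" "x \<in> chart_ran B i" for i x u v
    using B that unfolding is_semi_riemannian_def by blast+
  have bilF: "bilinear (metric F i x)" "metric F i x u v = metric F i x v u"
      "(\<forall>v. metric F i x u v = 0) \<longrightarrow> u = 0"
    if "i \<in> charts F" "x \<in> chart_ran F i" for i x u v
    using F that unfolding is_semi_riemannian_def by blast+
  {
    fix c assume c: "c \<in> charts (warped_product B f F)"
    obtain i j where ij: "c = (i, j)" "i \<in> charts B" "j \<in> charts F"
      using c by (auto simp: warped_simps)
    have op: "open (chart_ran B i \<times> chart_ran F j)"
      using chart_homeomorphic(2)[OF mB ij(2)] chart_homeomorphic(2)[OF mF ij(3)]
      by (rule open_Times)
    fix u v
    have sm: "smooth_on (chart_ran B i) (\<lambda>x. metric B i x (fst u) (fst v))"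
      "smooth_on (chart_ran B i) (\<lambda>x. f (chart_inv B i x))"
      "smooth_on (chart_ran F j) (\<lambda>x. metric F j x (snd u) (snd v))"
      using B F ij f(1) by (auto simp: is_semi_riemannian_def smooth_function_def comp_def)
    have "smooth_on (chart_ran B i \<times> chart_ran F j) (\<lambda>z. metric B i (fst z) (fst u) (fst v) +
        (f (chart_inv B i (fst z)) * f (chart_inv B i (fst z))) * metric F j (snd z) (snd u) (snd v))"
      by (intro smooth_on_add smooth_on_mult op
        smooth_on_compose_linear[OF bounded_linear_fst _ _ sm(1)]
        smooth_on_compose_linear[OF bounded_linear_fst _ _ sm(2)]
        smooth_on_compose_linear[OF bounded_linear_snd _ _ sm(3)]) auto
    then show "smooth_on (chart_ran (warped_product B f F) c)
        (\<lambda>x. metric (warped_product B f F) c x u v)"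
      by (simp add: ij warped_simps warped_chart_ran case_prod_unfold power2_eq_square)
  }
  {
    fix c z assume c: "c \<in> charts (warped_product B f F)"
      and z: "z \<in> chart_ran (warped_product B f F) c"
    obtain i j where ij: "c = (i, j)" "i \<in> charts B" "j \<in> charts F"
      using c by (auto simp: warped_simps)
    obtain x y where xy: "z = (x, y)" "x \<in> chart_ran B i" "y \<in> chart_ran F j"
      using z by (auto simp: ij warped_chart_ran)
    note bB = bilB[OF ij(2) xy(2)] and bF = bilF[OF ij(3) xy(3)] and fp = fpos[OF ij(2) xy(2)]
    show "bilinear (metric (warped_product B f F) c z)"
      using bB(1) bF(1)
      by (auto simp: ij xy(1) warped_simps bilinear_def linear_iff algebra_simps)
    fix u v
    show "metric (warped_product B f F) c z u v = metric (warped_product B f F) c z v u"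
      using bB(2) bF(2) by (simp add: ij xy(1) warped_simps case_prod_unfold)
    show "(\<forall>v. metric (warped_product B f F) c z u v = 0) \<longrightarrow> u = 0"
    proof
      assume 0: "\<forall>v. metric (warped_product B f F) c z u v = 0"
      have "metric B i x (fst u) v = 0" for v
        using 0[rule_format, of "(v, 0)"]
        by (simp add: ij xy(1) warped_simps case_prod_unfold bilinear_rzero[OF bF(1)])
      moreover have "metric F j y (snd u) v = 0" for v
        using 0[rule_format, of "(0, v)"] fp
        by (simp add: ij xy(1) warped_simps case_prod_unfold bilinear_rzero[OF bB(1)])
      ultimately show "u = 0"
        using bB(3) bF(3) by (simp add: prod_eq_iff)
    qed
  }
  {
    fix c c' z and u v :: "'d \<times> 'e" assume c: "c \<in> charts (warped_product B f F)" "c' \<in> charts (warped_product B f F)"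
      and z: "z \<in> overlap (warped_product B f F) c c'"
    obtain i j where ij: "c = (i, j)" "i \<in> charts B" "j \<in> charts F"
      using c by (auto simp: warped_simps)
    obtain i' j' where ij': "c' = (i', j')" "i' \<in> charts B" "j' \<in> charts F"
      using c by (auto simp: warped_simps)
    obtain x y where xy: "z = (x, y)" "x \<in> overlap B i i'" "y \<in> overlap F j j'"
      using z by (auto simp: ij ij' warped_overlap)
    let ?T = "transition B i i'" and ?S = "transition F j j'"
    have "(?T has_derivative dir_deriv ?T x) (at x)" "(?S has_derivative dir_deriv ?S y) (at y)"
      using smooth_on_has_derivative[OF smooth_transition[OF mB ij(2) ij'(2)] xy(2)]
        smooth_on_has_derivative[OF smooth_transition[OF mF ij(3) ij'(3)] xy(3)] by auto
    then have D1: "((\<lambda>z. (?T (fst z), ?S (snd z))) has_derivative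
        (\<lambda>d. (dir_deriv ?T x (fst d), dir_deriv ?S y (snd d)))) (at z)"
      unfolding xy(1) by (rule has_derivative_pair_maps)
    have op: "open (overlap B i i' \<times> overlap F j j')"
      using open_overlap mB mF ij ij' by (metis open_Times)
    have T: "transition (warped_product B f F) c c' z' = (?T (fst z'), ?S (snd z'))"
      if "z' \<in> overlap B i i' \<times> overlap F j j'" for z'
      using that warped_transition[OF mB ij(2) mF ij(3), of "fst z'" "snd z'"]
        subsetD[OF overlap_subset, of "fst z'" B i i'] subsetD[OF overlap_subset, of "snd z'" F j j']
      by (auto simp: ij ij')
    have D: "dir_deriv (transition (warped_product B f F) c c') z d
        = (dir_deriv ?T x (fst d), dir_deriv ?S y (snd d))" for d
      by (rule dir_deriv_eq_open[OF D1 op _ T]) (simp_all add: xy)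
    \<comment> \<open>Both base charts describe the same point \<open>p\<close>, so the warping
      function has the same value in both, and the transformation laws of \<open>B\<close> and
      \<open>F\<close> combine.\<close>
    obtain p where p: "x = chart B i p" "p \<in> chart_dom B i" "p \<in> chart_dom B i'"
      using xy(2) by (auto simp: overlap_def)
    have "chart_inv B i' (?T x) = chart_inv B i x"
      using chart_inv_chart[OF mB] p ij ij' by (simp add: transition_def)
    moreover have "metric B i x (fst u) (fst v)
        = metric B i' (?T x) (dir_deriv ?T x (fst u)) (dir_deriv ?T x (fst v))"
      using B ij ij' xy(2) unfolding is_semi_riemannian_def by blast
    moreover have "metric F j y (snd u) (snd v)
        = metric F j' (?S y) (dir_deriv ?S y (snd u)) (dir_deriv ?S y (snd v))"
      using F ij ij' xy(3) unfolding is_semi_riemannian_def by blast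
    ultimately show "metric (warped_product B f F) c z u v = metric (warped_product B f F) c'
        (transition (warped_product B f F) c c' z)
        (dir_deriv (transition (warped_product B f F) c c') z u)
        (dir_deriv (transition (warped_product B f F) c c') z v)"
      using xy D T[of z] by (simp add: ij(1) ij'(1) warped_simps case_prod_unfold)
  }
  obtain \<nu> where \<nu>: "\<And>i x. i \<in> charts B \<Longrightarrow> x \<in> chart_ran B i \<Longrightarrow> form_index (metric B i x) = \<nu>"
    using B unfolding is_semi_riemannian_def by metis
  obtain \<nu>' where \<nu>': "\<And>i x. i \<in> charts F \<Longrightarrow> x \<in> chart_ran F i \<Longrightarrow> form_index (metric F i x) = \<nu>'"
    using F unfolding is_semi_riemannian_def by metis
  show "\<exists>\<nu>. \<forall>c\<in>charts (warped_product B f F). \<forall>z\<in>chart_ran (warped_product B f F) c.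
      form_index (metric (warped_product B f F) c z) = \<nu>"
  proof (intro exI ballI)
    fix c z assume c: "c \<in> charts (warped_product B f F)"
      and z: "z \<in> chart_ran (warped_product B f F) c"
    obtain i j where ij: "c = (i, j)" "i \<in> charts B" "j \<in> charts F"
      using c by (auto simp: warped_simps)
    obtain x y where xy: "z = (x, y)" "x \<in> chart_ran B i" "y \<in> chart_ran F j"
      using z by (auto simp: ij warped_chart_ran)
    have "form_index (\<lambda>(u, u') (v, v'). metric B i x u v
        + (f (chart_inv B i x))\<^sup>2 * metric F j y u' v') = \<nu> + \<nu>'"
      using form_index_prod[OF bilB(1,2)[OF ij(2) xy(2)] bilF(1,2)[OF ij(3) xy(3)]]
        fpos[OF ij(2) xy(2)] \<nu>[OF ij(2) xy(2)] \<nu>'[OF ij(3) xy(3)] by simp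
    then show "form_index (metric (warped_product B f F) c z) = \<nu> + \<nu>'"
      by (simp add: ij xy warped_simps)
  qed
qed

lemma smooth_function_warped_product:
  assumes "is_smooth_manifold B" "is_smooth_manifold F" "smooth_function B h"
  shows "smooth_function (warped_product B f F) (\<lambda>(p, q). h p)"
  unfolding smooth_function_def
proof
  fix c assume c: "c \<in> charts (warped_product B f F)"
  obtain i j where ij: "c = (i, j)" "i \<in> charts B" "j \<in> charts F"
    using c by (auto simp: warped_simps)
  have op: "open (chart_ran B i \<times> chart_ran F j)"
    using chart_homeomorphic(2)[OF assms(1) ij(2)] chart_homeomorphic(2)[OF assms(2) ij(3)]
    by (rule open_Times)
  have "smooth_on (chart_ran B i) (h \<circ> chart_inv B i)"
    using assms(3) ij(2) by (auto simp: smooth_function_def)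
  then have s1: "smooth_on (chart_ran B i \<times> chart_ran F j) (\<lambda>z. (h \<circ> chart_inv B i) (fst z))"
    by (rule smooth_on_compose_linear[OF bounded_linear_fst op, rotated]) auto
  have s2: "((\<lambda>(p, q). h p) \<circ> chart_inv (warped_product B f F) c) z
      = (h \<circ> chart_inv B i) (fst z)"
    if "z \<in> chart_ran B i \<times> chart_ran F j" for z
    using that warped_chart_inv[OF assms(1) ij(2) assms(2) ij(3), of "fst z" "snd z"]
    by (auto simp: ij)
  show "smooth_on (chart_ran (warped_product B f F) c)
      ((\<lambda>(p, q). h p) \<circ> chart_inv (warped_product B f F) c)"
    using iffD2[OF smooth_on_cong[OF op s2] s1] by (simp only: ij(1) warped_chart_ran)
qed

end

section \<open>Open subsets of Euclidean space as manifolds with one chart\<close>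

lemma euclidean_domain_simps:
  "mtop (euclidean_domain U g) = top_of_set U" "charts (euclidean_domain U g) = {()}"
  "chart_dom (euclidean_domain U g) i = U" "chart (euclidean_domain U g) i = (\<lambda>p. p)"
  "metric (euclidean_domain U g) i = g" "chart_ran (euclidean_domain U g) i = U"
  "overlap (euclidean_domain U g) i j = U"
  "x \<in> U \<Longrightarrow> chart_inv (euclidean_domain U g) i x = x"
  "x \<in> U \<Longrightarrow> transition (euclidean_domain U g) i j x = x"
  using inv_into_f_f[of "\<lambda>p. p" U x]
  by (simp_all add: euclidean_domain_def chart_ran_def overlap_def transition_def chart_inv_def)

lemma is_smooth_manifold_euclidean_domain:
  assumes "open U"
  shows "is_smooth_manifold (euclidean_domain U g)"
proof -
  have "second_countable (euclidean :: 'a topology)"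
  proof -
    obtain B :: "'a set set" where B: "countable B" "topological_basis B"
      using ex_countable_basis by blast
    then show ?thesis unfolding second_countable_def
      using topological_basis_open[OF B(2)] topological_basisE[OF B(2)]
      unfolding open_openin[symmetric] by (intro exI[of _ B]) (metis B(1))
  qed
  moreover have "homeomorphic_map (top_of_set U) (top_of_set U) (\<lambda>p. p)"
    using homeomorphic_map_id[of "top_of_set U" "top_of_set U"] by (simp add: id_def)
  moreover have "smooth_on U (transition (euclidean_domain U g) i j)" for i j
    using smooth_on_cong[OF assms, of "transition (euclidean_domain U g) i j" "\<lambda>x. x"]
      smooth_on_id[OF assms] by (simp add: euclidean_domain_simps)
  ultimately show ?thesis
    using assms
    by (auto simp: is_smooth_manifold_def euclidean_domain_simps Hausdorff_space_subtopology
        second_countable_subtopology subtopology_subtopology)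
qed

lemma smooth_function_euclidean_domain:
  assumes "open U" "smooth_on U h"
  shows "smooth_function (euclidean_domain U g) h"
  using smooth_on_cong[OF assms(1), of "h \<circ> chart_inv (euclidean_domain U g) ()" h] assms(2)
  by (simp add: smooth_function_def euclidean_domain_simps)

lemma is_semi_riemannian_euclidean_domain:
  assumes "open U" "\<And>u v. smooth_on U (\<lambda>x. g x u v)" "\<And>x. x \<in> U \<Longrightarrow> bilinear (g x)"
    and "\<And>x u v. x \<in> U \<Longrightarrow> g x u v = g x v u"
    and "\<And>x u. x \<in> U \<Longrightarrow> (\<And>v. g x u v = 0) \<Longrightarrow> u = 0"
    and "\<And>x. x \<in> U \<Longrightarrow> form_index (g x) = \<nu>"
  shows "is_semi_riemannian (euclidean_domain U g)"
proof -
  have "dir_deriv (transition (euclidean_domain U g) i j) x u = u" if "x \<in> U" for i j x u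
    using assms(1) that
    by (intro dir_deriv_eq_open[OF has_derivative_ident]) (auto simp: euclidean_domain_simps)
  then show ?thesis
    using assms is_smooth_manifold_euclidean_domain[OF assms(1), of g]
    by (auto simp: is_semi_riemannian_def euclidean_domain_simps)
qed

section \<open>The Levi-Civita connection in a coordinate domain\<close>

lemma differentiable_prod:
  fixes f :: "'i \<Rightarrow> 'a::real_normed_vector \<Rightarrow> 'b::real_normed_field"
  assumes "\<And>i. i \<in> I \<Longrightarrow> f i differentiable (at x)"
  shows "(\<lambda>y. \<Prod>i\<in>I. f i y) differentiable (at x)"
  using assms has_derivative_prod[of I f _ x UNIV] unfolding differentiable_def by metis

lemma differentiable_det:
  fixes M :: "'a::real_normed_vector \<Rightarrow> real ^ 'm ^ 'm"
  assumes "\<And>i j. (\<lambda>y. M y $ i $ j) differentiable (at x)"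
  shows "(\<lambda>y. det (M y)) differentiable (at x)"
  unfolding det_def
  by (intro differentiable_sum differentiable_mult differentiable_const differentiable_prod
      ballI assms) auto

text \<open>Existence behind \<open>christoffel\<close>: the operator \<open>L\<close> representing
  \<open>b\<close> is injective by nondegeneracy, hence surjective in finite dimension, and a
  preimage of the vector of values of \<open>K\<close> is the required \<open>w\<close>.\<close>

lemma bilinear_nondegenerate_representation:
  fixes b :: "'e::euclidean_space \<Rightarrow> 'e \<Rightarrow> real"
  assumes "bilinear b" "\<And>u. (\<And>v. b u v = 0) \<Longrightarrow> u = 0" "linear K"
  shows "\<exists>w. \<forall>t. b w t = K t"
proof -
  define L where "L w = (\<Sum>e\<in>Basis. b w e *\<^sub>R e)" for w
  have lin: "linear L"
    by (rule linearI) (simp_all add: L_def bilinear_ladd[OF assms(1)] bilinear_lmul[OF assms(1)]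
        scaleR_add_left sum.distrib scaleR_sum_right)
  have ext: "f t = (\<Sum>e\<in>Basis. (t \<bullet> e) * f e)" if "linear f" for f :: "'e \<Rightarrow> real" and t
    using linear_sum[OF that, of "\<lambda>e. (t \<bullet> e) *\<^sub>R e" Basis] linear_scale[OF that]
    by (simp add: euclidean_representation)
  have b: "b w t = t \<bullet> L w" for w t
  proof -
    have "linear (b w)" using assms(1) by (simp add: bilinear_def)
    then show ?thesis using ext[of "b w" t] by (simp add: L_def inner_sum_right mult.commute)
  qed
  have "inj L"
    using assms(2) by (simp add: linear_injective_0[OF lin] b)
  then have "surj L" using lin linear_injective_imp_surjective by blast
  then obtain w where w: "L w = (\<Sum>e\<in>Basis. K e *\<^sub>R e)" by (metis surjD)
  have "b w t = K t" for t
    using ext[OF assms(3), of t] by (simp add: b w inner_sum_right mult.commute)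
  then show ?thesis by blast
qed

text \<open>The right-hand side inside the definite description of \<open>christoffel\<close>, named
  so that its linearity in \<open>t\<close>, symmetry in \<open>u\<close> and \<open>v\<close>, and
  differentiability in the base point can be stated.\<close>

definition koszul :: "'e::euclidean_space local_metric \<Rightarrow> 'e \<Rightarrow> 'e \<Rightarrow> 'e \<Rightarrow> 'e \<Rightarrow> real" where
  "koszul g x u v t =
     (dir_deriv (\<lambda>y. g y v t) x u + dir_deriv (\<lambda>y. g y u t) x v - dir_deriv (\<lambda>y. g y u v) x t) / 2"

text \<open>Allows a proposed connection to be verified against the Koszul formula instead of being
  solved for; nondegeneracy gives uniqueness.\<close>

lemma christoffel_eqI:
  assumes "bilinear (g x)" "\<And>u. (\<And>v. g x u v = 0) \<Longrightarrow> u = 0"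
    and "\<And>t. g x w t = koszul g x u v t"
  shows "christoffel g x u v = w"
  unfolding christoffel_def koszul_def[symmetric]
proof (rule the_equality)
  fix w' assume "\<forall>t. g x w' t = koszul g x u v t"
  then have "g x (w' - w) t = 0" for t
    using assms(3) by (simp add: bilinear_lsub[OF assms(1)])
  then show "w' = w" using assms(2) by fastforce
qed (use assms(3) in blast)

text \<open>A semi-Riemannian metric as seen in a single chart, the level at which curvature is
  computed.\<close>

locale semi_riemannian_domain =
  fixes S :: "'e::euclidean_space set" and g :: "'e local_metric"
  assumes open_S: "open S"
    and smooth: "\<And>u v. smooth_on S (\<lambda>x. g x u v)"
    and bil: "\<And>x. x \<in> S \<Longrightarrow> bilinear (g x)"
    and sym: "\<And>x u v. x \<in> S \<Longrightarrow> g x u v = g x v u"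
    and nondeg: "\<And>x u. x \<in> S \<Longrightarrow> (\<And>v. g x u v = 0) \<Longrightarrow> u = 0"
begin

abbreviation dg :: "'e \<Rightarrow> 'e \<Rightarrow> 'e \<Rightarrow> 'e \<Rightarrow> real" where
  "dg x u v d \<equiv> dir_deriv (\<lambda>y. g y u v) x d"

lemma has_derivative_metric: "x \<in> S \<Longrightarrow> ((\<lambda>y. g y u v) has_derivative dg x u v) (at x)"
  using smooth_on_has_derivative[OF smooth] by fast

lemma dg_linear: "x \<in> S \<Longrightarrow> linear (dg x u v)"
  using has_derivative_metric has_derivative_linear by blast

lemma dg_sym: "x \<in> S \<Longrightarrow> dg x u v d = dg x v u d"
  using sym by (intro dir_deriv_eq_open[OF has_derivative_metric open_S])

lemma dg_add: "x \<in> S \<Longrightarrow> dg x (u + u') v d = dg x u v d + dg x u' v d"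
  by (rule dir_deriv_eq_open[OF has_derivative_add[OF has_derivative_metric has_derivative_metric]
        open_S]) (simp_all add: bilinear_ladd[OF bil])

lemma dg_scale: "x \<in> S \<Longrightarrow> dg x (c *\<^sub>R u) v d = c * dg x u v d"
  by (rule dir_deriv_eq_open[OF has_derivative_mult_right[OF has_derivative_metric] open_S])
    (simp_all add: bilinear_lmul[OF bil])

lemma koszul_linear:
  assumes x: "x \<in> S"
  shows "linear (koszul g x u v)"
proof (rule linearI)
  have r: "dg x w (a + b) d = dg x w a d + dg x w b d" "dg x w (c *\<^sub>R a) d = c * dg x w a d"
    for w a b c d
    using dg_add[OF x, of a b w d] dg_scale[OF x, of c a w d] dg_sym[OF x] by metis+
  show "koszul g x u v (a + b) = koszul g x u v a + koszul g x u v b" for a b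
    by (simp add: koszul_def r linear_add[OF dg_linear[OF x]] field_simps)
  show "koszul g x u v (c *\<^sub>R a) = c *\<^sub>R koszul g x u v a" for c a
    by (simp add: koszul_def r linear_scale[OF dg_linear[OF x]] field_simps)
qed

lemma koszul_sym: "x \<in> S \<Longrightarrow> koszul g x u v t = koszul g x v u t"
  by (simp add: koszul_def dg_sym[of x u v])

lemma metric_christoffel:
  assumes x: "x \<in> S"
  shows "g x (christoffel g x u v) t = koszul g x u v t"
proof -
  obtain w where w: "\<And>t. g x w t = koszul g x u v t"
    using bilinear_nondegenerate_representation[OF bil[OF x] nondeg[OF x] koszul_linear[OF x]]
    by blast
  then have "christoffel g x u v = w"
    by (intro christoffel_eqI bil[OF x] nondeg[OF x])
  then show ?thesis by (simp add: w)
qed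

lemma christoffel_unique:
  "x \<in> S \<Longrightarrow> (\<And>t. g x w t = koszul g x u v t) \<Longrightarrow> christoffel g x u v = w"
  by (rule christoffel_eqI[OF bil nondeg])

lemma christoffel_sym: "x \<in> S \<Longrightarrow> christoffel g x u v = christoffel g x v u"
  by (rule christoffel_unique) (simp_all add: metric_christoffel koszul_sym[of x u v])

lemma bilinear_christoffel:
  assumes x: "x \<in> S"
  shows "bilinear (christoffel g x)"
proof -
  have "linear (\<lambda>u. christoffel g x u v)" for v
  proof (rule linearI)
    show "christoffel g x (a + b) v = christoffel g x a v + christoffel g x b v" for a b
      by (rule christoffel_unique[OF x])
        (simp add: bilinear_ladd[OF bil[OF x]] metric_christoffel[OF x] koszul_def
          linear_add[OF dg_linear[OF x]] dg_add[OF x] field_simps)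
    show "christoffel g x (c *\<^sub>R a) v = c *\<^sub>R christoffel g x a v" for c a
      by (rule christoffel_unique[OF x])
        (simp add: bilinear_lmul[OF bil[OF x]] metric_christoffel[OF x] koszul_def
          linear_scale[OF dg_linear[OF x]] dg_scale[OF x] field_simps)
  qed
  moreover from this have "linear (\<lambda>v. christoffel g x u v)" for u
    using christoffel_sym[OF x, of u] by simp
  ultimately show ?thesis by (simp add: bilinear_def)
qed

lemma koszul_differentiable:
  assumes x: "x \<in> S"
  shows "(\<lambda>y. koszul g y u v t) differentiable (at x)"
proof -
  have "(\<lambda>y. dg y a b d) differentiable (at x)" for a b d
    using smooth_on_has_derivative[OF smooth_on_dir_deriv[OF smooth] x]
    unfolding differentiable_def by blast
  then show ?thesis unfolding koszul_def by (intro derivative_intros) simp_all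
qed

end

text \<open>Cramer's rule expresses the Christoffel symbols as rational functions of the metric and its
  first derivatives.\<close>

lemma christoffel_differentiable:
  fixes g :: "(real ^ 'm) local_metric"
  assumes "semi_riemannian_domain S g" and x: "x \<in> S"
  shows "(\<lambda>y. christoffel g y u v) differentiable (at x)"
proof -
  interpret semi_riemannian_domain S g by fact
  define M :: "real ^ 'm \<Rightarrow> real ^ 'm ^ 'm" where "M y = (\<chi> i j. g y (axis j 1) (axis i 1))" for y
  \<comment> \<open>\<open>N k\<close> is the Gram matrix \<open>M\<close> with column
    \<open>k\<close> replaced by the Koszul right-hand side, the numerator of component
    \<open>k\<close> in Cramer's rule.\<close>
  define N :: "'m \<Rightarrow> real ^ 'm \<Rightarrow> real ^ 'm ^ 'm" where
    "N k y = (\<chi> i j. if j = k then koszul g y u v (axis i 1) else g y (axis j 1) (axis i 1))" for k y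
  have M: "M y *v w = (\<chi> i. g y w (axis i 1))" if y: "y \<in> S" for y w
  proof -
    have "linear (\<lambda>w. g y w t)" for t using bil[OF y] by (simp add: bilinear_def)
    then have "(\<Sum>j\<in>UNIV. w $ j * g y (axis j 1) t) = g y (\<Sum>j\<in>UNIV. w $ j *\<^sub>R axis j 1) t" for t
      using linear_sum[of "\<lambda>w. g y w t" "\<lambda>j. w $ j *\<^sub>R axis j 1" UNIV]
      by (simp add: bilinear_lmul[OF bil[OF y]])
    then show ?thesis unfolding basis_expansion[of w, unfolded scalar_mult_eq_scaleR]
      by (simp add: M_def matrix_vector_mult_def vec_eq_iff mult.commute)
  qed
  have det: "det (M y) \<noteq> 0" if y: "y \<in> S" for y
  proof -
    have "w = 0" if "M y *v w = 0" for w
    proof (rule nondeg[OF y])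
      fix t
      have "linear (g y w)" using bil[OF y] by (simp add: bilinear_def)
      then have "g y w (\<Sum>j\<in>UNIV. t $ j *\<^sub>R axis j 1) = (\<Sum>j\<in>UNIV. t $ j * g y w (axis j 1))"
        using linear_sum[of "g y w" "\<lambda>j. t $ j *\<^sub>R axis j 1" UNIV]
        by (simp add: bilinear_rmul[OF bil[OF y]])
      also have "\<dots> = 0" using that by (simp add: M[OF y] vec_eq_iff)
      finally show "g y w t = 0" unfolding basis_expansion[of t, unfolded scalar_mult_eq_scaleR] .
    qed
    then have "inj ((*v) (M y))" by (simp add: linear_injective_0)
    then show ?thesis using det_nz_iff_inj[of "(*v) (M y)"] by simp
  qed
  have eq: "christoffel g y u v = (\<chi> k. det (N k y) / det (M y))" if y: "y \<in> S" for y
  proof -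
    have "M y *v christoffel g y u v = (\<chi> i. koszul g y u v (axis i 1))"
      by (simp add: M[OF y] metric_christoffel[OF y])
    then show ?thesis
      using cramer[OF det[OF y]] by (simp add: N_def M_def cong: if_cong)
  qed
  have d: "(\<lambda>y. g y a b) differentiable (at x)" for a b
    using has_derivative_metric[OF x] unfolding differentiable_def by blast
  have "(\<lambda>y. det (N k y) / det (M y)) differentiable (at x)" for k
  proof (intro differentiable_divide differentiable_det det[OF x])
    show "(\<lambda>y. N k y $ i $ j) differentiable (at x)" for i j
      using koszul_differentiable[OF x] d by (cases "j = k") (simp_all add: N_def)
    show "(\<lambda>y. M y $ i $ j) differentiable (at x)" for i j
      using d by (simp add: M_def)
  qed
  \<comment> \<open>Differentiability of the components gives that of the vector through its
    expansion in the standard basis.\<close>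
  then have "(\<lambda>y. \<Sum>k\<in>UNIV. (det (N k y) / det (M y)) *\<^sub>R axis k 1 :: real ^ 'm) differentiable (at x)"
    by (intro differentiable_sum differentiable_scaleR) auto
  then have "(\<lambda>y. \<chi> k. det (N k y) / det (M y)) differentiable (at x)"
    using basis_expansion[of "\<chi> k. det (N k y) / det (M y)" for y, unfolded scalar_mult_eq_scaleR]
    by simp
  then show ?thesis
    using eq has_derivative_transform_within_open[OF _ open_S x] unfolding differentiable_def
    by (metis (no_types, lifting))
qed

section \<open>Curvature of a warped product over a conformally flat base\<close>

lemma sum_Basis_prod:
  fixes h :: "'a::euclidean_space \<times> 'b::euclidean_space \<Rightarrow> 'c::comm_monoid_add"
  shows "(\<Sum>e\<in>Basis. h e) = (\<Sum>e\<in>Basis. h (e, 0)) + (\<Sum>e\<in>Basis. h (0, e))"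
proof -
  have "inj_on (\<lambda>u. (u::'a, 0::'b)) Basis" "inj_on (\<lambda>u. (0::'a, u::'b)) Basis"
    by (auto intro!: inj_onI)
  then show ?thesis
    unfolding Basis_prod_def
    by (subst sum.union_disjoint) (auto simp: Basis_prod_def sum.reindex)
qed

text \<open>This is the trace of the rank-one map sending \<open>e\<close> to
  \<open>h e *\<^sub>R x\<close>, the shape of most terms in the Ricci contraction.\<close>

lemma trace_rank_one:
  fixes h :: "'a::euclidean_space \<Rightarrow> real"
  assumes "linear h"
  shows "(\<Sum>e\<in>Basis. h e * (x \<bullet> e)) = h x"
  using linear_sum[OF assms, of "\<lambda>e. (x \<bullet> e) *\<^sub>R e" Basis] linear_scale[OF assms]
  by (simp add: euclidean_representation mult.commute)

text \<open>\<open>\<sigma>\<close> and \<open>\<mu>\<close> are the logarithmic derivatives of \<open>\<phi>\<close> and \<open>f\<close>, and \<open>\<beta>\<close> is the gradient of the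
  coordinate \<open>\<xi> = \<alpha> \<bullet> p\<close> with respect to the flat metric \<open>b\<close>.\<close>

locale warped_conformal = F: semi_riemannian_domain T gF
  for T :: "(real ^ 'm) set" and gF :: "(real ^ 'm) local_metric" +
  fixes b :: "'d::euclidean_space \<Rightarrow> 'd \<Rightarrow> real" and \<alpha> \<beta> :: 'd and I :: "real set"
    and \<phi> f \<sigma> \<mu> \<sigma>' \<mu>' :: "real \<Rightarrow> real" and G :: "('d \<times> (real ^ 'm)) local_metric"
  assumes b_bil: "bilinear b" and b_sym: "\<And>u v. b u v = b v u"
    and b_nondeg: "\<And>u. (\<And>v. b u v = 0) \<Longrightarrow> u = 0"
    and dual: "\<And>v. b \<beta> v = \<alpha> \<bullet> v"
    and open_I: "open I"
    and \<phi>_nz: "\<And>t. t \<in> I \<Longrightarrow> \<phi> t \<noteq> 0" and f_nz: "\<And>t. t \<in> I \<Longrightarrow> f t \<noteq> 0"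
    and \<phi>_deriv: "\<And>t. t \<in> I \<Longrightarrow> (\<phi> has_real_derivative \<sigma> t * \<phi> t) (at t)"
    and f_deriv: "\<And>t. t \<in> I \<Longrightarrow> (f has_real_derivative \<mu> t * f t) (at t)"
    and \<sigma>_deriv: "\<And>t. t \<in> I \<Longrightarrow> (\<sigma> has_real_derivative \<sigma>' t) (at t)"
    and \<mu>_deriv: "\<And>t. t \<in> I \<Longrightarrow> (\<mu> has_real_derivative \<mu>' t) (at t)"
    and G_eq: "\<And>p q u u' v v'. \<alpha> \<bullet> p \<in> I \<Longrightarrow> q \<in> T \<Longrightarrow>
      G (p, q) (u, u') (v, v') = b u v / (\<phi> (\<alpha> \<bullet> p))\<^sup>2 + (f (\<alpha> \<bullet> p))\<^sup>2 * gF q u' v'"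
begin

definition D :: "('d \<times> (real ^ 'm)) set" where "D = {z. \<alpha> \<bullet> fst z \<in> I} \<inter> UNIV \<times> T"

lemma open_D: "open D"
proof -
  have "open ((\<lambda>z. \<alpha> \<bullet> fst z) -` I)"
    by (intro open_vimage open_I continuous_intros)
  moreover have "open (UNIV \<times> T)" using F.open_S by (intro open_Times) auto
  ultimately show ?thesis unfolding D_def vimage_def by (rule open_Int)
qed

lemma D_iff: "(p, q) \<in> D \<longleftrightarrow> \<alpha> \<bullet> p \<in> I \<and> q \<in> T"
  by (auto simp: D_def)

lemma has_derivative_base:
  assumes "(h has_real_derivative h') (at (\<alpha> \<bullet> p))"
  shows "((\<lambda>z. h (\<alpha> \<bullet> fst z)) has_derivative (\<lambda>d. h' * (\<alpha> \<bullet> fst d))) (at (p, q))"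
proof -
  have "((\<lambda>z. \<alpha> \<bullet> fst z) has_derivative (\<lambda>d. \<alpha> \<bullet> fst d)) (at (p, q))"
    by (intro derivative_intros)
  then show ?thesis
    using has_derivative_compose[of _ _ _ _ h] assms by (fastforce simp: has_field_derivative_def)
qed

lemma has_derivative_fibre:
  assumes "(h has_derivative h') (at q)"
  shows "((\<lambda>z. h (snd z)) has_derivative (\<lambda>d. h' (snd d))) (at (p, q))"
  using assms
  by (intro has_derivative_compose[OF bounded_linear_imp_has_derivative[OF bounded_linear_snd]]) simp

lemma dir_deriv_G:
  assumes "(p, q) \<in> D"
  shows "dir_deriv (\<lambda>z. G z (u, u') (v, v')) (p, q) (d, d')
    = - 2 * \<sigma> (\<alpha> \<bullet> p) / (\<phi> (\<alpha> \<bullet> p))\<^sup>2 * (\<alpha> \<bullet> d) * b u v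
      + 2 * \<mu> (\<alpha> \<bullet> p) * (f (\<alpha> \<bullet> p))\<^sup>2 * (\<alpha> \<bullet> d) * gF q u' v'
      + (f (\<alpha> \<bullet> p))\<^sup>2 * F.dg q u' v' d'"
proof -
  let ?t = "\<alpha> \<bullet> p"
  have t: "?t \<in> I" and q: "q \<in> T" using assms by (auto simp: D_iff)
  have 1: "((\<lambda>t. 1 / (\<phi> t)\<^sup>2) has_real_derivative - 2 * \<sigma> ?t / (\<phi> ?t)\<^sup>2) (at ?t)"
    using \<phi>_nz[OF t]
    by (auto intro!: derivative_eq_intros \<phi>_deriv[OF t] simp: field_simps power2_eq_square)
  have 2: "((\<lambda>t. (f t)\<^sup>2) has_real_derivative 2 * \<mu> ?t * (f ?t)\<^sup>2) (at ?t)"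
    by (auto intro!: derivative_eq_intros f_deriv[OF t] simp: field_simps power2_eq_square)
  have 3: "((\<lambda>z. 1 / (\<phi> (\<alpha> \<bullet> fst z))\<^sup>2 * b u v + (f (\<alpha> \<bullet> fst z))\<^sup>2 * gF (snd z) u' v')
      has_derivative (\<lambda>d. (- 2 * \<sigma> ?t / (\<phi> ?t)\<^sup>2 * (\<alpha> \<bullet> fst d)) * b u v
        + ((f (\<alpha> \<bullet> fst (p, q)))\<^sup>2 * F.dg q u' v' (snd d)
        + (2 * \<mu> ?t * (f ?t)\<^sup>2 * (\<alpha> \<bullet> fst d)) * gF (snd (p, q)) u' v'))) (at (p, q))"
    by (intro has_derivative_add has_derivative_mult has_derivative_mult_left
        has_derivative_base[OF 1] has_derivative_base[OF 2]
        has_derivative_fibre[OF F.has_derivative_metric[OF q]])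
  show ?thesis
    by (subst dir_deriv_eq_open[OF 3 open_D assms])
      (auto simp: G_eq D_def algebra_simps)
qed

text \<open>\<open>gam\<close> is the Levi-Civita connection of \<open>G\<close>: \<open>W\<close> is that of the conformal base metric, and
  \<open>P t *\<^sub>R \<beta>\<close> is \<open>f grad f\<close>, the gradient being taken in the base metric.\<close>

definition W :: "real \<Rightarrow> 'd \<Rightarrow> 'd \<Rightarrow> 'd" where
  "W t u v = - \<sigma> t *\<^sub>R ((\<alpha> \<bullet> u) *\<^sub>R v + (\<alpha> \<bullet> v) *\<^sub>R u - b u v *\<^sub>R \<beta>)"

definition P :: "real \<Rightarrow> real" where "P t = (\<phi> t)\<^sup>2 * (f t)\<^sup>2 * \<mu> t"

definition gam :: "'d \<times> (real ^ 'm) \<Rightarrow> 'd \<times> (real ^ 'm) \<Rightarrow> 'd \<times> (real ^ 'm) \<Rightarrow> 'd \<times> (real ^ 'm)" where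
  "gam z V V' = (W (\<alpha> \<bullet> fst z) (fst V) (fst V') - (P (\<alpha> \<bullet> fst z) * gF (snd z) (snd V) (snd V')) *\<^sub>R \<beta>,
     christoffel gF (snd z) (snd V) (snd V')
       + \<mu> (\<alpha> \<bullet> fst z) *\<^sub>R ((\<alpha> \<bullet> fst V) *\<^sub>R snd V' + (\<alpha> \<bullet> fst V') *\<^sub>R snd V))"

lemmas b_lin = bilinear_ladd[OF b_bil] bilinear_radd[OF b_bil] bilinear_lmul[OF b_bil]
  bilinear_rmul[OF b_bil] bilinear_lsub[OF b_bil] bilinear_rsub[OF b_bil]
  bilinear_lneg[OF b_bil] bilinear_rneg[OF b_bil] bilinear_lzero[OF b_bil] bilinear_rzero[OF b_bil]

text \<open>Paired with an arbitrary vector, \<open>gam\<close> has to reproduce the Koszul formula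
  of \<open>G\<close>: the fibre derivatives are matched by the Koszul formula of \<open>gF\<close>,
  the derivatives along \<xi> by \<open>dual\<close>.\<close>

lemma christoffel_G:
  assumes z: "z \<in> D"
  shows "christoffel G z V V' = gam z V V'"
proof -
  obtain p q where pq: "z = (p, q)" by force
  obtain u u' where u: "V = (u, u')" by force
  obtain v v' where v: "V' = (v, v')" by force
  let ?t = "\<alpha> \<bullet> p"
  have t: "?t \<in> I" and q: "q \<in> T" using assms by (auto simp: D_iff pq)
  have bF: "bilinear (gF q)" by (rule F.bil[OF q])
  note F_lin = bilinear_ladd[OF bF] bilinear_radd[OF bF] bilinear_lmul[OF bF] bilinear_rmul[OF bF]
    bilinear_lzero[OF bF] bilinear_rzero[OF bF]
  show ?thesis unfolding pq
  proof (rule christoffel_eqI)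
    show "bilinear (G (p, q))"
      by (auto simp: bilinear_def linear_iff G_eq[OF t q] b_lin F_lin algebra_simps add_divide_distrib)
    show "x = 0" if x: "\<And>y. G (p, q) x y = 0" for x
    proof -
      obtain x1 x2 where x12: "x = (x1, x2)" by force
      have "b x1 y = 0" for y
        using x[of "(y, 0)"] \<phi>_nz[OF t] by (simp add: x12 G_eq[OF t q] F_lin)
      moreover have "gF q x2 y = 0" for y
        using x[of "(0, y)"] f_nz[OF t] by (simp add: x12 G_eq[OF t q] b_lin)
      ultimately show ?thesis using b_nondeg F.nondeg[OF q] by (simp add: x12 zero_prod_def)
    qed
    fix y :: "'d \<times> (real ^ 'm)"
    obtain y1 y2 where y: "y = (y1, y2)" by force
    have K: "gF q (christoffel gF q u' v') y2
        = (F.dg q v' y2 u' + F.dg q u' y2 v' - F.dg q u' v' y2) / 2"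
      using F.metric_christoffel[OF q] by (simp add: koszul_def)
    \<comment> \<open>Naming the square leaves one nonzero atom as denominator, which the simplifier
      can clear.\<close>
    define A where "A = (\<phi> ?t)\<^sup>2"
    have "A \<noteq> 0" using \<phi>_nz[OF t] by (simp add: A_def)
    then show "G (p, q) (gam (p, q) V V') y = koszul G (p, q) V V' y"
      unfolding koszul_def y u v dir_deriv_G[OF z[unfolded pq]]
      by (simp add: gam_def G_eq[OF t q] W_def P_def b_lin A_def[symmetric] F_lin K dual b_sym[of _ \<beta>]
          F.sym[OF q, of v' u'] field_simps)
  qed
qed


section \<open>Curvature and Hessian of the warped metric\<close>

definition P' :: "real \<Rightarrow> real" where
  "P' t = (\<phi> t)\<^sup>2 * (f t)\<^sup>2 * (2 * (\<sigma> t + \<mu> t) * \<mu> t + \<mu>' t)"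

lemma P_deriv: "t \<in> I \<Longrightarrow> (P has_real_derivative P' t) (at t)"
  unfolding P_def[abs_def] P'_def
  by (auto intro!: derivative_eq_intros \<phi>_deriv f_deriv \<mu>_deriv simp: algebra_simps power2_eq_square)

text \<open>The derivative of \<open>gam z V V'\<close> in \<open>z\<close> along \<open>d\<close>,
  with \<open>V\<close> and \<open>V'\<close> held constant as coordinate fields.\<close>

definition dgam where
  "dgam z V V' d = (- (\<sigma>' (\<alpha> \<bullet> fst z) * (\<alpha> \<bullet> fst d)) *\<^sub>R
         ((\<alpha> \<bullet> fst V) *\<^sub>R fst V' + (\<alpha> \<bullet> fst V') *\<^sub>R fst V - b (fst V) (fst V') *\<^sub>R \<beta>)
       - (P (\<alpha> \<bullet> fst z) * F.dg (snd z) (snd V) (snd V') (snd d)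
          + P' (\<alpha> \<bullet> fst z) * (\<alpha> \<bullet> fst d) * gF (snd z) (snd V) (snd V')) *\<^sub>R \<beta>,
     dir_deriv (\<lambda>y. christoffel gF y (snd V) (snd V')) (snd z) (snd d)
       + (\<mu>' (\<alpha> \<bullet> fst z) * (\<alpha> \<bullet> fst d)) *\<^sub>R
         ((\<alpha> \<bullet> fst V) *\<^sub>R snd V' + (\<alpha> \<bullet> fst V') *\<^sub>R snd V))"

lemma has_derivative_christoffel_F:
  assumes "q \<in> T"
  shows "((\<lambda>y. christoffel gF y u v) has_derivative dir_deriv (\<lambda>y. christoffel gF y u v) q) (at q)"
  using christoffel_differentiable[OF F.semi_riemannian_domain_axioms assms]
  by (simp add: dir_deriv_def[abs_def] frechet_derivative_works)

lemma dir_deriv_christoffel_G: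
  assumes z: "z \<in> D"
  shows "dir_deriv (\<lambda>y. christoffel G y V V') z d = dgam z V V' d"
proof -
  obtain p q where pq: "z = (p, q)" by force
  have t: "\<alpha> \<bullet> p \<in> I" and q: "q \<in> T" using assms by (auto simp: D_iff pq)
  have "((\<lambda>z. gam z V V') has_derivative dgam (p, q) V V') (at (p, q))"
    unfolding gam_def dgam_def W_def
    by (rule has_derivative_eq_rhs, (rule has_derivative_Pair has_derivative_add has_derivative_diff
          has_derivative_scaleR_left has_derivative_minus has_derivative_mult
          has_derivative_base[OF \<sigma>_deriv[OF t]] has_derivative_base[OF \<mu>_deriv[OF t]]
          has_derivative_base[OF P_deriv[OF t]] has_derivative_fibre[OF F.has_derivative_metric[OF q]]
          has_derivative_fibre[OF has_derivative_christoffel_F[OF q]])+)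
      (simp add: fun_eq_iff algebra_simps)
  then show ?thesis
    unfolding pq by (rule dir_deriv_eq_open[OF _ open_D z[unfolded pq] christoffel_G])
qed

lemma riemann_G:
  assumes "z \<in> D"
  shows "riemann G z U V V' = dgam z V V' U - dgam z U V' V
    + gam z U (gam z V V') - gam z V (gam z U V')"
  by (simp add: riemann_def dir_deriv_christoffel_G[OF assms] christoffel_G[OF assms])

text \<open>As \<open>\<sigma>' + \<sigma>^2 = \<phi>'' / \<phi>\<close> and
  \<open>\<mu>' + \<mu>^2 = f'' / f\<close>, this is the classical formula: on the base, the Ricci
  tensor of the conformally flat metric minus \<open>(m / f) * Hess f\<close>; on the fibre, its own
  Ricci tensor minus \<open>(f * Laplacian f + (m - 1) * |grad f|^2) * gF\<close>. The trace is
  taken separately over the basis vectors \<open>(e, 0)\<close> and \<open>(0, e)\<close>.\<close>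

lemma local_ricci_G:
  fixes p v w :: 'd and q v' w' :: "real ^ 'm"
  assumes t: "\<alpha> \<bullet> p \<in> I" and q: "q \<in> T"
  defines "t \<equiv> \<alpha> \<bullet> p" and "n \<equiv> real DIM('d)" and "m \<equiv> real CARD('m)" and "s \<equiv> \<alpha> \<bullet> \<beta>"
  shows "local_ricci G (p, q) (v, v') (w, w') = local_ricci gF q v' w'
    + ((n - 2) * (\<sigma>' t + (\<sigma> t)\<^sup>2) - m * (\<mu>' t + (\<mu> t)\<^sup>2 + 2 * \<sigma> t * \<mu> t))
        * (\<alpha> \<bullet> v) * (\<alpha> \<bullet> w)
    + s * b v w * (\<sigma>' t + (\<sigma> t)\<^sup>2 - (n - 1) * (\<sigma> t)\<^sup>2 + m * \<sigma> t * \<mu> t)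
    - s * gF q v' w' * (P' t - n * \<sigma> t * P t + (m - 2) * \<mu> t * P t)"
proof -
  have z: "(p, q) \<in> D" using t q by (simp add: D_iff)
  have bF: "bilinear (gF q)" by (rule F.bil[OF q])
  note F_lin = bilinear_ladd[OF bF] bilinear_radd[OF bF] bilinear_lmul[OF bF] bilinear_rmul[OF bF]
    bilinear_lzero[OF bF] bilinear_rzero[OF bF]
  have bC: "bilinear (christoffel gF q)" by (rule F.bilinear_christoffel[OF q])
  note C_lin = bilinear_ladd[OF bC] bilinear_radd[OF bC] bilinear_lmul[OF bC] bilinear_rmul[OF bC]
    bilinear_lzero[OF bC] bilinear_rzero[OF bC]
  \<comment> \<open>\<open>X\<close> is the base component of the covariant derivative of
    \<open>(w, w')\<close> along \<open>(v, v')\<close>, and \<open>Y e\<close> that along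
    \<open>(e, 0)\<close>. Keeping \<open>Y\<close> folded lets the traces of its compositions with
    linear forms be taken first.\<close>
  define X where "X = W t v w - (P t * gF q v' w') *\<^sub>R \<beta>"
  define Y where "Y e = W t e w" for e
  have lY: "linear Y"
    by (rule linearI) (simp_all add: Y_def W_def b_lin algebra_simps inner_add_left inner_add_right)
  have lb: "linear (b x)" "linear (\<lambda>e. b e x)" for x
    using b_bil by (auto simp: bilinear_def)
  have l\<alpha>: "linear ((\<bullet>) \<alpha>)" by (rule linearI) (simp_all add: inner_add_right)
  have tr: "(\<Sum>e\<in>Basis. (\<alpha> \<bullet> e) * (x \<bullet> e)) = \<alpha> \<bullet> x"
    "(\<Sum>e\<in>Basis. b e y * (x \<bullet> e)) = b x y"
    "(\<Sum>e\<in>Basis. (\<alpha> \<bullet> Y e) * (x \<bullet> e)) = \<alpha> \<bullet> Y x"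
    "(\<Sum>e\<in>Basis. b v (Y e) * (x \<bullet> e)) = b v (Y x)" for x y
    using trace_rank_one[OF l\<alpha>, of x] trace_rank_one[OF lb(2), of y x]
      trace_rank_one[OF linear_compose[OF lY l\<alpha>], of x]
      trace_rank_one[OF linear_compose[OF lY lb(1)[of v]], of x]
    by (simp_all add: comp_def)
  have dual': "b u \<beta> = \<alpha> \<bullet> u" for u
    using dual[of u] b_sym[of u \<beta>] by simp
  \<comment> \<open>The two rank-one terms of \<open>W\<close> cancel in the trace; the multiple of
    the identity contributes the factor \<open>n\<close>.\<close>
  have trY: "(\<Sum>e\<in>Basis. Y e \<bullet> e) = - n * \<sigma> t * (\<alpha> \<bullet> w)"
  proof -
    have "(\<Sum>e\<in>Basis. Y e \<bullet> e) = (\<Sum>e\<in>Basis. - \<sigma> t * ((\<alpha> \<bullet> e) * (w \<bullet> e))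
        + (- \<sigma> t * (\<alpha> \<bullet> w)) * 1 + \<sigma> t * (b e w * (\<beta> \<bullet> e)))"
      by (intro sum.cong) (auto simp: Y_def W_def algebra_simps inner_Basis)
    also have "\<dots> = - n * \<sigma> t * (\<alpha> \<bullet> w)"
      unfolding sum.distrib sum_distrib_left[symmetric] tr
      by (simp add: n_def dual)
    finally show ?thesis .
  qed
  have base: "(\<Sum>e\<in>Basis. fst (riemann G (p, q) (e, 0) (v, v') (w, w')) \<bullet> e)
      = (n - 2) * (\<sigma>' t + (\<sigma> t)\<^sup>2) * (\<alpha> \<bullet> v) * (\<alpha> \<bullet> w)
        + s * b v w * (\<sigma>' t - (n - 2) * (\<sigma> t)\<^sup>2)
        + s * gF q v' w' * (n * \<sigma> t * P t + \<mu> t * P t - P' t)"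
  proof -
    \<comment> \<open>Every summand is a coefficient free of \<open>e\<close> times a term with
      known trace. The factor \<open>1\<close> marks multiples of the identity, whose traces give
      \<open>n\<close>.\<close>
    have "(\<Sum>e\<in>Basis. fst (riemann G (p, q) (e, 0) (v, v') (w, w')) \<bullet> e) =
      (\<Sum>e\<in>Basis. - \<sigma>' t * (\<alpha> \<bullet> w) * ((\<alpha> \<bullet> e) * (v \<bullet> e))
        + (\<sigma>' t * b v w - P' t * gF q v' w') * ((\<alpha> \<bullet> e) * (\<beta> \<bullet> e))
        + (\<sigma>' t * (\<alpha> \<bullet> v) * (\<alpha> \<bullet> w)) * 1
        + (- \<sigma>' t * (\<alpha> \<bullet> v)) * (b e w * (\<beta> \<bullet> e))
        + (- \<sigma> t) * ((\<alpha> \<bullet> e) * (X \<bullet> e))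
        + (- \<sigma> t * (\<alpha> \<bullet> X)) * 1
        + \<sigma> t * (b e X * (\<beta> \<bullet> e))
        + (\<sigma> t * (\<alpha> \<bullet> v)) * (Y e \<bullet> e)
        + \<sigma> t * ((\<alpha> \<bullet> Y e) * (v \<bullet> e))
        + (- \<sigma> t) * (b v (Y e) * (\<beta> \<bullet> e))
        + (P t * \<mu> t * gF q v' w') * ((\<alpha> \<bullet> e) * (\<beta> \<bullet> e)))"
    proof (rule sum.cong)
      fix e :: 'd assume e: "e \<in> Basis"
      have Xe: "fst (gam (p, q) (v, v') (w, w')) = X" by (simp add: gam_def X_def t_def)
      have Ye: "gam (p, q) (e, 0) (w, w') = (Y e, (\<mu> t * (\<alpha> \<bullet> e)) *\<^sub>R w')"
        by (simp add: gam_def Y_def t_def F_lin C_lin)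
      have 1: "fst (gam (p, q) (e, 0) Z) = W t e (fst Z)" for Z
        by (simp add: gam_def t_def F_lin)
      have 2: "fst (gam (p, q) (v, v') (Y e, (\<mu> t * (\<alpha> \<bullet> e)) *\<^sub>R w'))
          = W t v (Y e) - (P t * \<mu> t * gF q v' w' * (\<alpha> \<bullet> e)) *\<^sub>R \<beta>"
        by (simp add: gam_def t_def F_lin)
      \<comment> \<open>The direction \<open>(e, 0)\<close> has zero fibre part, which enters the
        derivative of the connection as an argument of the fibre metric.\<close>
      have 3: "F.dg q 0 w' v' = 0"
        using F.dg_scale[OF q, of 0 0 w' v'] by simp
      show "fst (riemann G (p, q) (e, 0) (v, v') (w, w')) \<bullet> e =
         - \<sigma>' t * (\<alpha> \<bullet> w) * ((\<alpha> \<bullet> e) * (v \<bullet> e))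
        + (\<sigma>' t * b v w - P' t * gF q v' w') * ((\<alpha> \<bullet> e) * (\<beta> \<bullet> e))
        + (\<sigma>' t * (\<alpha> \<bullet> v) * (\<alpha> \<bullet> w)) * 1
        + (- \<sigma>' t * (\<alpha> \<bullet> v)) * (b e w * (\<beta> \<bullet> e))
        + (- \<sigma> t) * ((\<alpha> \<bullet> e) * (X \<bullet> e))
        + (- \<sigma> t * (\<alpha> \<bullet> X)) * 1
        + \<sigma> t * (b e X * (\<beta> \<bullet> e))
        + (\<sigma> t * (\<alpha> \<bullet> v)) * (Y e \<bullet> e)
        + \<sigma> t * ((\<alpha> \<bullet> Y e) * (v \<bullet> e))
        + (- \<sigma> t) * (b v (Y e) * (\<beta> \<bullet> e))
        + (P t * \<mu> t * gF q v' w') * ((\<alpha> \<bullet> e) * (\<beta> \<bullet> e))"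
        unfolding riemann_G[OF z] Ye fst_add fst_diff 1 2 Xe
        using e linear_0[OF F.dg_linear[OF q]]
        by (simp add: dgam_def W_def F_lin 3 t_def[symmetric] inner_add_left inner_diff_left
            inner_same_Basis algebra_simps)
    qed simp
    also have "\<dots> = (n - 2) * (\<sigma>' t + (\<sigma> t)\<^sup>2) * (\<alpha> \<bullet> v) * (\<alpha> \<bullet> w)
        + s * b v w * (\<sigma>' t - (n - 2) * (\<sigma> t)\<^sup>2)
        + s * gF q v' w' * (n * \<sigma> t * P t + \<mu> t * P t - P' t)"
      unfolding sum.distrib sum_distrib_left[symmetric] tr trY
      by (simp add: X_def Y_def W_def b_lin dual dual' s_def n_def[symmetric] inner_add_right inner_diff_right
          power2_eq_square algebra_simps)
    finally show ?thesis .
  qed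
  have fibre: "(\<Sum>e\<in>Basis. snd (riemann G (p, q) (0, e) (v, v') (w, w')) \<bullet> e)
      = local_ricci gF q v' w' + m * (\<mu> t * (\<alpha> \<bullet> X) - (\<alpha> \<bullet> v) * (\<alpha> \<bullet> w) * (\<mu>' t + (\<mu> t)\<^sup>2))
        + \<mu> t * P t * s * gF q v' w'"
  proof -
    \<comment> \<open>Along the fibre the curvature operator splits into that of \<open>gF\<close>,
      a multiple of the identity (hence the factor \<open>m\<close>), and a rank-one map.\<close>
    have "snd (riemann G (p, q) (0, e) (v, v') (w, w')) = riemann gF q e v' w'
        + (\<mu> t * (\<alpha> \<bullet> X) - (\<alpha> \<bullet> v) * (\<alpha> \<bullet> w) * (\<mu>' t + (\<mu> t)\<^sup>2)) *\<^sub>R e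
        + (\<mu> t * P t * s * gF q e w') *\<^sub>R v'" for e
    proof -
      have X: "gam (p, q) (v, v') (w, w') = (X, christoffel gF q v' w'
          + \<mu> t *\<^sub>R ((\<alpha> \<bullet> v) *\<^sub>R w' + (\<alpha> \<bullet> w) *\<^sub>R v'))"
        by (simp add: gam_def X_def t_def)
      have Y: "gam (p, q) (0, e) (w, w') = (- (P t * gF q e w') *\<^sub>R \<beta>,
          christoffel gF q e w' + (\<mu> t * (\<alpha> \<bullet> w)) *\<^sub>R e)"
        by (simp add: gam_def W_def t_def b_lin)
      show ?thesis
        unfolding riemann_G[OF z] X Y snd_add snd_diff
        by (simp add: gam_def dgam_def riemann_def t_def[symmetric] C_lin s_def
            F.christoffel_sym[OF q, of v' e] power2_eq_square algebra_simps)
    qed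
    then have "(\<Sum>e\<in>Basis. snd (riemann G (p, q) (0, e) (v, v') (w, w')) \<bullet> e) =
        (\<Sum>e\<in>Basis. riemann gF q e v' w' \<bullet> e
        + (\<mu> t * (\<alpha> \<bullet> X) - (\<alpha> \<bullet> v) * (\<alpha> \<bullet> w) * (\<mu>' t + (\<mu> t)\<^sup>2)) * 1
        + (\<mu> t * P t * s) * (gF q e w' * (v' \<bullet> e)))"
      by (intro sum.cong) (auto simp: inner_add_left inner_same_Basis)
    also have "\<dots> = local_ricci gF q v' w'
        + m * (\<mu> t * (\<alpha> \<bullet> X) - (\<alpha> \<bullet> v) * (\<alpha> \<bullet> w) * (\<mu>' t + (\<mu> t)\<^sup>2))
        + \<mu> t * P t * s * gF q v' w'"
      using trace_rank_one[of "\<lambda>e. gF q e w'" v'] bF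
      unfolding sum.distrib sum_distrib_left[symmetric]
      by (simp add: m_def local_ricci_def bilinear_def)
    finally show ?thesis .
  qed
  have "local_ricci G (p, q) (v, v') (w, w')
      = (\<Sum>e\<in>Basis. fst (riemann G (p, q) (e, 0) (v, v') (w, w')) \<bullet> e)
      + (\<Sum>e\<in>Basis. snd (riemann G (p, q) (0, e) (v, v') (w, w')) \<bullet> e)"
    unfolding local_ricci_def sum_Basis_prod by (simp add: inner_prod_def)
  then show ?thesis
    unfolding base fibre
    by (simp add: X_def W_def s_def inner_add_right inner_diff_right power2_eq_square algebra_simps)
qed

text \<open>For a function of \<xi> only, the Hessian is \<open>h''\<close> on d\<xi>^2 minus
  \<open>h'\<close> times the \<xi>-component of the connection. \<open>H\<close> is prescribed only
  over the domain because it will contain \<open>chart_inv\<close>.\<close>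

lemma local_hess_G:
  fixes p v w :: 'd and q v' w' :: "real ^ 'm"
  assumes t: "\<alpha> \<bullet> p \<in> I" and q: "q \<in> T"
    and h: "\<And>t. t \<in> I \<Longrightarrow> (h has_real_derivative h' t) (at t)"
      "\<And>t. t \<in> I \<Longrightarrow> (h' has_real_derivative h'' t) (at t)"
    and H: "\<And>p q. \<alpha> \<bullet> p \<in> I \<Longrightarrow> q \<in> T \<Longrightarrow> H (p, q) = h (\<alpha> \<bullet> p)"
  defines "t \<equiv> \<alpha> \<bullet> p" and "s \<equiv> \<alpha> \<bullet> \<beta>"
  shows "local_hess G H (p, q) (v, v') (w, w') =
    (h'' t + 2 * h' t * \<sigma> t) * (\<alpha> \<bullet> v) * (\<alpha> \<bullet> w)
    - s * b v w * h' t * \<sigma> t + s * gF q v' w' * h' t * P t"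
proof -
  have z: "(p, q) \<in> D" using t q by (simp add: D_iff)
  have 1: "dir_deriv H (p, q) (d, d') = h' (\<alpha> \<bullet> p) * (\<alpha> \<bullet> d)" if "(p, q) \<in> D" for p q d d'
  proof (subst dir_deriv_eq_open[OF has_derivative_base[OF h(1)] open_D that])
    show "\<alpha> \<bullet> p \<in> I" using that by (simp add: D_iff)
  qed (auto simp: D_def H)
  have "dir_deriv (\<lambda>y. dir_deriv H y (w, w')) (p, q) (v, v') = h'' t * (\<alpha> \<bullet> v) * (\<alpha> \<bullet> w)"
    by (subst dir_deriv_eq_open[OF has_derivative_mult_left[OF has_derivative_base[OF h(2)[OF t]]] open_D z])
      (auto simp: D_def 1 t_def)
  then show ?thesis
    unfolding local_hess_def christoffel_G[OF z]
    by (simp add: gam_def 1[OF z] W_def s_def t_def inner_add_right inner_diff_right algebra_simps)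
qed

end

section \<open>The soliton equation\<close>

lemma smooth_on_imp_DERIV_deriv:
  fixes f :: "real \<Rightarrow> real"
  assumes "smooth_on I f" "t \<in> I"
  shows "(f has_real_derivative deriv f t) (at t)"
  using smooth_on_has_derivative[OF assms] unfolding DERIV_deriv_iff_real_differentiable
  by (auto simp: differentiable_def)

lemma differentiable_on_imp_DERIV_deriv:
  fixes f :: "real \<Rightarrow> real"
  assumes "f differentiable_on I" "open I" "t \<in> I"
  shows "(f has_real_derivative deriv f t) (at t)"
  using assms by (simp add: DERIV_deriv_iff_real_differentiable differentiable_on_eq_differentiable_at)

text \<open>With \<open>A\<close> and \<open>B\<close> the two bases, the exponents in
  \<open>z'\<close> exceed those in \<open>x\<close> by one each, so
  \<open>z' = - x * A * B\<close>. Logarithmic differentiation of \<open>x\<close> then gives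
  \<open>x' / x = (r / A + s / B) * z' = - (r * B + s * A) * x\<close>.\<close>

lemma powr_system_derivs:
  fixes x z :: "real \<Rightarrow> real"
  assumes "open I" "t \<in> I" "N > 0" "a = k / N"
    and pos: "\<And>t. t \<in> I \<Longrightarrow> z t + k - N > 0"
    and z: "(z has_real_derivative z') (at t)"
    and x_eq: "\<And>t. t \<in> I \<Longrightarrow>
      x t = c * (z t + k - N) powr ((a - 1) / 2) * (z t + k + N) powr (- ((a + 1) / 2))"
    and z_eq: "z' = - c * (z t + k - N) powr ((a + 1) / 2) * (z t + k + N) powr (- ((a - 1) / 2))"
  shows "z' = - x t * ((z t + k)\<^sup>2 - N\<^sup>2)" "(x has_real_derivative z t * (x t)\<^sup>2) (at t)"
proof -
  define A where "A = z t + k - N"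
  define B where "B = z t + k + N"
  have AB: "A > 0" "B > 0" using pos[OF assms(2)] assms(3) by (auto simp: A_def B_def)
  have "A powr ((a + 1) / 2) = A powr ((a - 1) / 2) * A"
    using AB powr_add[of A "(a - 1) / 2" 1] by (simp add: field_simps)
  moreover have "B powr (- ((a - 1) / 2)) = B powr (- ((a + 1) / 2)) * B"
  proof -
    have "- ((a - 1) / 2) = - ((a + 1) / 2) + 1" by (simp add: field_simps)
    then show ?thesis using AB by (simp only: powr_add) simp
  qed
  ultimately have z': "z' = - x t * (A * B)"
    unfolding z_eq x_eq[OF assms(2)] A_def[symmetric] B_def[symmetric] by simp
  then show "z' = - x t * ((z t + k)\<^sup>2 - N\<^sup>2)"
    by (simp add: A_def B_def power2_eq_square algebra_simps)
  define r where "r = (a - 1) / 2"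
  define s where "s = - ((a + 1) / 2)"
  have dA: "((\<lambda>t. (z t + k - N) powr r) has_real_derivative r * A powr (r - 1) * z') (at t)"
    using DERIV_fun_powr[of "\<lambda>t. z t + k - N" z' t r] AB
    by (auto intro!: derivative_eq_intros z simp: A_def)
  have dB: "((\<lambda>t. (z t + k + N) powr s) has_real_derivative s * B powr (s - 1) * z') (at t)"
    using DERIV_fun_powr[of "\<lambda>t. z t + k + N" z' t s] AB
    by (auto intro!: derivative_eq_intros z simp: B_def)
  have "((\<lambda>t. c * (z t + k - N) powr r * (z t + k + N) powr s) has_real_derivative
      c * (r * A powr (r - 1) * z') * B powr s + s * B powr (s - 1) * z' * (c * A powr r)) (at t)"
    using DERIV_mult[OF DERIV_cmult[OF dA, of c] dB] by (simp add: A_def B_def)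
  moreover have "c * (r * A powr (r - 1) * z') * B powr s + s * B powr (s - 1) * z' * (c * A powr r)
      = z t * (x t)\<^sup>2"
  proof -
    have "A powr (r - 1) = A powr r / A" "B powr (s - 1) = B powr s / B"
      using AB powr_diff[of A r 1] powr_diff[of B s 1] by simp_all
    moreover have "x t = c * A powr r * B powr s"
      using x_eq[OF assms(2)] by (simp add: A_def B_def r_def s_def)
    ultimately have "c * (r * A powr (r - 1) * z') * B powr s + s * B powr (s - 1) * z' * (c * A powr r)
        = (r / A + s / B) * z' * x t"
      by (simp add: algebra_simps)
    also have "\<dots> = - (r * B + s * A) * (x t)\<^sup>2"
      using AB unfolding z' by (simp add: field_simps power2_eq_square)
    \<comment> \<open>Here \<open>r + s = -1\<close> and \<open>r - s = a\<close>, so the left side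
      is \<open>- (z t + k) + a * N\<close>; the choice of \<open>a\<close> makes
      \<open>a * N = k\<close>.\<close>
    also have "r * B + s * A = - z t"
      using assms(3,4) by (simp add: A_def B_def r_def s_def field_simps)
    finally show ?thesis by simp
  qed
  ultimately have "((\<lambda>t. c * (z t + k - N) powr r * (z t + k + N) powr s)
      has_real_derivative z t * (x t)\<^sup>2) (at t)" by simp
  then show "(x has_real_derivative z t * (x t)\<^sup>2) (at t)"
    using has_field_derivative_transform_within_open[OF _ assms(1,2)] x_eq
    by (simp add: r_def s_def)
qed

lemma pseudo_euclidean_metric_eq:
  "pseudo_euclidean_metric \<epsilon> p u v = (\<Sum>i\<in>UNIV. \<epsilon> i * u $ i * v $ i)"
proof -
  have "(\<Sum>j\<in>UNIV. (if i = j then \<epsilon> i else 0) * u $ i * v $ j) = \<epsilon> i * u $ i * v $ i" for i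
    by (subst sum.cong[OF refl, where h = "\<lambda>j. if j = i then \<epsilon> i * u $ i * v $ i else 0"]) auto
  then show ?thesis by (simp add: pseudo_euclidean_metric_def)
qed

lemma pseudo_euclidean_metric_props:
  fixes \<epsilon> :: "'n::finite \<Rightarrow> real"
  shows "bilinear (pseudo_euclidean_metric \<epsilon> p)"
    and "pseudo_euclidean_metric \<epsilon> p u v = pseudo_euclidean_metric \<epsilon> p v u"
    and "(\<And>i. \<epsilon> i \<noteq> 0) \<Longrightarrow> (\<And>v. pseudo_euclidean_metric \<epsilon> p u v = 0) \<Longrightarrow> u = 0"
proof -
  show "bilinear (pseudo_euclidean_metric \<epsilon> p)"
    by (auto simp: bilinear_def linear_iff pseudo_euclidean_metric_eq algebra_simps sum.distrib
        sum_distrib_left)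
  show "pseudo_euclidean_metric \<epsilon> p u v = pseudo_euclidean_metric \<epsilon> p v u"
    by (simp add: pseudo_euclidean_metric_eq mult.commute mult.left_commute)
  assume nz: "\<And>i. \<epsilon> i \<noteq> 0" and 0: "\<And>v. pseudo_euclidean_metric \<epsilon> p u v = 0"
  have "u $ i = 0" for i
  proof -
    have "(\<Sum>j\<in>UNIV. \<epsilon> j * u $ j * axis i 1 $ j) = (\<Sum>j\<in>UNIV. if j = i then \<epsilon> i * u $ i else 0)"
      by (intro sum.cong) (auto simp: axis_def)
    then show ?thesis using 0[of "axis i 1"] nz[of i] by (simp add: pseudo_euclidean_metric_eq)
  qed
  then show "u = 0" by (simp add: vec_eq_iff)
qed

theorem theorem1p5:
  fixes n m :: nat
    and \<epsilon> \<alpha> :: "'n::finite \<Rightarrow> real"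
    and k c\<^sub>3 a :: real
    and I :: "real set"
    and x z \<phi> f h :: "real \<Rightarrow> real"
    and \<xi> :: "real ^ 'n \<Rightarrow> real"
    and F :: "('q, 'j, real ^ 'm::finite) semi_riemannian"
  assumes n: "n = CARD('n)" "n \<ge> 3"
    and m: "m = CARD('m)" "m \<ge> 1"
    and eps: "\<And>i. \<epsilon> i = 1 \<or> \<epsilon> i = -1"
    and alpha: "(\<Sum>i\<in>UNIV. \<epsilon> i * (\<alpha> i)\<^sup>2) = 1 \<or> (\<Sum>i\<in>UNIV. \<epsilon> i * (\<alpha> i)\<^sup>2) = -1"
    and xi: "\<And>p. \<xi> p = (\<Sum>i\<in>UNIV. \<alpha> i * p $ i)"
    and k: "k > 0" and c3: "c\<^sub>3 > 0"
    and a: "a = k / sqrt (real m + k\<^sup>2 * (real n - 1))"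
    and I: "open I" "is_interval I"
    and smooth: "smooth_on I x" "smooth_on I z"
    and base_pos: "\<And>t. t \<in> I \<Longrightarrow> z t + k - sqrt (real m + k\<^sup>2 * (real n - 1)) > 0"
    and x_eq: "\<And>t. t \<in> I \<Longrightarrow>
      x t = c\<^sub>3 * (z t + k - sqrt (real m + k\<^sup>2 * (real n - 1))) powr ((a - 1) / 2)
               * (z t + k + sqrt (real m + k\<^sup>2 * (real n - 1))) powr (- ((a + 1) / 2))"
    and z_eq: "\<And>t. t \<in> I \<Longrightarrow>
      deriv z t = - c\<^sub>3 * (z t + k - sqrt (real m + k\<^sup>2 * (real n - 1))) powr ((a + 1) / 2)
               * (z t + k + sqrt (real m + k\<^sup>2 * (real n - 1))) powr (- ((a - 1) / 2))"
    and diff: "\<phi> differentiable_on I" "f differentiable_on I" "h differentiable_on I"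
    and f_pos: "\<And>t. t \<in> I \<Longrightarrow> f t > 0"
    and phi_nz: "\<And>t. t \<in> I \<Longrightarrow> \<phi> t \<noteq> 0"
    and phi_eq: "\<And>t. t \<in> I \<Longrightarrow> deriv \<phi> t / \<phi> t = k * (deriv f t / f t)"
    and f_eq: "\<And>t. t \<in> I \<Longrightarrow> deriv f t / f t = x t"
    and h_eq: "\<And>t. t \<in> I \<Longrightarrow> deriv h t = (z t + real m - k * (real n - 2)) * x t"
    and F: "is_semi_riemannian F" "ricci_flat F"
  shows "steady_gradient_ricci_soliton
     (warped_product
        (euclidean_domain {p. \<xi> p \<in> I} (conformal_metric (\<phi> \<circ> \<xi>) (pseudo_euclidean_metric \<epsilon>)))
        (f \<circ> \<xi>) F)
     (\<lambda>(p, q). h (\<xi> p))"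
proof -
  define N where "N = sqrt (real m + k\<^sup>2 * (real n - 1))"
  have N2: "N\<^sup>2 = real m + k\<^sup>2 * (real n - 1)" and N: "N > 0"
    using n m by (auto simp: N_def intro!: add_pos_nonneg)
  have zd: "(z has_real_derivative - x t * ((z t + k)\<^sup>2 - N\<^sup>2)) (at t)"
    and xd: "(x has_real_derivative z t * (x t)\<^sup>2) (at t)" if t: "t \<in> I" for t
    using powr_system_derivs[OF I(1) t N a[folded N_def] base_pos[folded N_def]
        smooth_on_imp_DERIV_deriv[OF smooth(2) t] x_eq[folded N_def] z_eq[OF t, folded N_def]]
      smooth_on_imp_DERIV_deriv[OF smooth(2) t] by auto
  have fd: "(f has_real_derivative x t * f t) (at t)" if t: "t \<in> I" for t
    using differentiable_on_imp_DERIV_deriv[OF diff(2) I(1) t] f_eq[OF t] f_pos[OF t]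
    by (simp add: field_simps)
  have \<phi>d: "(\<phi> has_real_derivative (k * x t) * \<phi> t) (at t)" if t: "t \<in> I" for t
    using differentiable_on_imp_DERIV_deriv[OF diff(1) I(1) t] phi_eq[OF t] f_eq[OF t] phi_nz[OF t]
    by (simp add: field_simps)
  define h' where "h' t = (z t + real m - k * (real n - 2)) * x t" for t
  \<comment> \<open>The product rule for \<open>h'\<close> with both differential equations
    inserted, so that only \<open>x\<close> and \<open>z\<close> remain.\<close>
  define h'' where "h'' t = - x t * ((z t + k)\<^sup>2 - N\<^sup>2) * x t
    + (z t + real m - k * (real n - 2)) * (z t * (x t)\<^sup>2)" for t
  have hd: "(h has_real_derivative h' t) (at t)" if t: "t \<in> I" for t
    using differentiable_on_imp_DERIV_deriv[OF diff(3) I(1) t] h_eq[OF t] by (simp add: h'_def)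
  have h'd: "(h' has_real_derivative h'' t) (at t)" if t: "t \<in> I" for t
    unfolding h'_def[abs_def] h''_def
    by (auto intro!: derivative_eq_intros zd[OF t] xd[OF t] simp: algebra_simps)
  have f_smooth: "smooth_on I f"
    by (rule smooth_on_linear_ode[OF I(1) fd smooth(1)])
  have h'_eq: "h' = (\<lambda>t. (z t + (real m - k * (real n - 2))) * x t)"
    by (simp add: h'_def fun_eq_iff)
  have h'_smooth: "smooth_on I h'"
    unfolding h'_eq by (intro smooth_on_mult smooth_on_add smooth_on_const smooth I(1))
  have h_smooth: "smooth_on I h"
    by (rule smooth_on_antiderivative[OF I(1) hd h'_smooth])
  \<comment> \<open>The base metric involves \<phi> only through this factor, which itself solves a
    linear equation, with coefficient \<open>- 2 k x\<close>.\<close>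
  have \<psi>_smooth: "smooth_on I (\<lambda>t. 1 / (\<phi> t)\<^sup>2)"
  proof (rule smooth_on_linear_ode[OF I(1)])
    show "((\<lambda>t. 1 / (\<phi> t)\<^sup>2) has_real_derivative - (2 * k) * x t * (1 / (\<phi> t)\<^sup>2)) (at t)"
      if t: "t \<in> I" for t
      using phi_nz[OF t]
      by (auto intro!: derivative_eq_intros \<phi>d[OF t] simp: field_simps power2_eq_square)
    show "smooth_on I (\<lambda>t. - (2 * k) * x t)"
      by (intro smooth_on_mult smooth_on_const smooth I(1))
  qed

  define \<alpha>\<^sub>v where "\<alpha>\<^sub>v = (\<chi> i. \<alpha> i)"
  \<comment> \<open>The index of \<alpha> is raised with the flat metric; duality rests on
    \<open>\<epsilon> i * \<epsilon> i = 1\<close>.\<close>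
  define \<beta> where "\<beta> = (\<chi> i. \<epsilon> i * \<alpha> i)"
  have \<xi>: "\<xi> = (\<bullet>) \<alpha>\<^sub>v"
    by (simp add: fun_eq_iff xi \<alpha>\<^sub>v_def inner_vec_def)
  have \<xi>_lin: "bounded_linear \<xi>" unfolding \<xi> by (rule bounded_linear_inner_right)
  define U where "U = {p. \<xi> p \<in> I}"
  have U: "open U"
    using open_vimage[OF I(1), of \<xi>] linear_continuous_on[OF \<xi>_lin] by (simp add: U_def vimage_def)
  define b where "b = pseudo_euclidean_metric \<epsilon> 0"
  have b: "pseudo_euclidean_metric \<epsilon> p = b" for p
    by (simp add: fun_eq_iff pseudo_euclidean_metric_eq b_def)
  have eps_nz: "\<epsilon> i \<noteq> 0" for i using eps[of i] by auto
  have eps_sq: "\<epsilon> i * (\<epsilon> i * r) = r" for i r using eps[of i] by auto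
  have b_bil: "bilinear b" and b_sym: "\<And>u v. b u v = b v u"
    and b_nd: "\<And>u. (\<And>v. b u v = 0) \<Longrightarrow> u = 0"
    unfolding b_def using pseudo_euclidean_metric_props eps_nz by blast+
  have dual: "b \<beta> v = \<alpha>\<^sub>v \<bullet> v" for v
    by (simp add: b_def pseudo_euclidean_metric_eq \<beta>_def \<alpha>\<^sub>v_def inner_vec_def eps_sq mult.assoc)

  define gB where "gB = conformal_metric (\<phi> \<circ> \<xi>) (pseudo_euclidean_metric \<epsilon>)"
  have gB: "gB p u v = 1 / (\<phi> (\<xi> p))\<^sup>2 * b u v" for p u v
    by (simp add: gB_def conformal_metric_def b)
  define B where "B = euclidean_domain U gB"
  have B_sr: "is_semi_riemannian B"
    unfolding B_def
  proof (rule is_semi_riemannian_euclidean_domain[OF U])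
    show "smooth_on U (\<lambda>p. gB p u v)" for u v
      unfolding gB
      by (rule smooth_on_mult[OF U smooth_on_compose_linear[OF \<xi>_lin U _ \<psi>_smooth] smooth_on_const[OF U]])
        (auto simp: U_def)
    fix p assume "p \<in> U"
    then have pos: "1 / (\<phi> (\<xi> p))\<^sup>2 > 0" using phi_nz by (simp add: U_def)
    have gB': "gB p = (\<lambda>u v. 1 / (\<phi> (\<xi> p))\<^sup>2 * b u v)" by (simp add: fun_eq_iff gB)
    show "bilinear (gB p)"
      using b_bil unfolding gB' by (auto simp: bilinear_def linear_iff add_divide_distrib)
    show "gB p u v = gB p v u" for u v by (simp add: gB b_sym[of u])
    show "u = 0" if "\<And>v. gB p u v = 0" for u using that pos b_nd by (simp add: gB)
    show "form_index (gB p) = form_index b" unfolding gB' by (rule form_index_scale[OF pos])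
  qed
  have h_B: "smooth_function B (\<lambda>p. h (\<xi> p))" and f_B: "smooth_function B (f \<circ> \<xi>)"
    using smooth_on_compose_linear[OF \<xi>_lin U _ h_smooth] smooth_on_compose_linear[OF \<xi>_lin U _ f_smooth]
    by (auto simp: B_def U_def comp_def intro!: smooth_function_euclidean_domain U[unfolded U_def])
  have mB: "is_smooth_manifold B" and mF: "is_smooth_manifold F"
    using B_sr F(1) by (auto simp: is_semi_riemannian_def)
  let ?M = "warped_product B (f \<circ> \<xi>) F"
  have "steady_gradient_ricci_soliton ?M (\<lambda>(p, q). h (\<xi> p))"
    unfolding steady_gradient_ricci_soliton_def
  proof (intro conjI ballI allI)
    show "is_semi_riemannian ?M"
      using f_pos by (intro is_semi_riemannian_warped_product B_sr F(1) f_B)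
        (auto simp: B_def euclidean_domain_simps U_def)
    show "smooth_function ?M (\<lambda>(p, q). h (\<xi> p))"
      by (rule smooth_function_warped_product[OF mB mF h_B])
    fix c y and u v :: "(real ^ 'n) \<times> (real ^ 'm)"
    assume c: "c \<in> charts ?M" and y: "y \<in> chart_ran ?M c"
    obtain i j where ij: "c = (i, j)" "i \<in> charts B" "j \<in> charts F"
      using c by (auto simp: warped_simps)
    let ?T = "chart_ran F j"
    have B_ran: "chart_ran B i = U" for i by (simp add: B_def euclidean_domain_simps)
    obtain p q where pq: "y = (p, q)" "p \<in> U" "q \<in> ?T"
      using y by (auto simp: ij(1) warped_chart_ran B_ran)
    have dom: "semi_riemannian_domain ?T (metric F j)"
      using F(1) ij(3) chart_homeomorphic(2)[OF mF ij(3)]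
      unfolding is_semi_riemannian_def semi_riemannian_domain_def by blast
    \<comment> \<open>The logarithmic derivatives are \<open>k x\<close> for \<phi> and
      \<open>x\<close> for \<open>f\<close>; their derivatives come from
      \<open>x' = z x^2\<close>.\<close>
    interpret warped_conformal ?T "metric F j" b \<alpha>\<^sub>v \<beta> I \<phi> f "\<lambda>t. k * x t" x
      "\<lambda>t. k * (z t * (x t)\<^sup>2)" "\<lambda>t. z t * (x t)\<^sup>2" "metric ?M c"
    proof (rule warped_conformal.intro[OF dom], unfold_locales)
      show "f t \<noteq> 0" "\<phi> t \<noteq> 0" if "t \<in> I" for t
        using f_pos[OF that] phi_nz[OF that] by simp_all
      show "metric ?M c (p, q) (u, u') (v, v')
          = b u v / (\<phi> (\<alpha>\<^sub>v \<bullet> p))\<^sup>2 + (f (\<alpha>\<^sub>v \<bullet> p))\<^sup>2 * metric F j q u' v'"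
        if "\<alpha>\<^sub>v \<bullet> p \<in> I" for p q u u' v v'
        using that by (simp add: ij(1) warped_simps B_def euclidean_domain_simps gB \<xi> U_def)
    qed (auto intro: b_bil b_sym b_nd dual I(1) phi_nz \<phi>d fd xd DERIV_cmult)
    obtain u1 u2 v1 v2 where uv: "u = (u1, u2)" "v = (v1, v2)" by force
    let ?t = "\<alpha>\<^sub>v \<bullet> p"
    have t: "?t \<in> I" using pq(2) by (simp add: U_def \<xi>)
    have H: "((\<lambda>(p, q). h (\<xi> p)) \<circ> chart_inv ?M c) (p, q) = h (\<alpha>\<^sub>v \<bullet> p)"
      if "\<alpha>\<^sub>v \<bullet> p \<in> I" "q \<in> ?T" for p q
    proof -
      have "p \<in> U" using that(1) by (simp add: U_def \<xi>)
      then show ?thesis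
        using warped_chart_inv[OF mB ij(2) mF ij(3), of p q "f \<circ> \<xi>"] that(2)
        by (simp add: ij(1) B_ran) (simp add: B_def euclidean_domain_simps \<xi>)
    qed
    have hess: "local_hess (metric ?M c) ((\<lambda>(p, q). h (\<xi> p)) \<circ> chart_inv ?M c) (p, q) (u1, u2) (v1, v2)
        = (h'' ?t + 2 * h' ?t * (k * x ?t)) * (\<alpha>\<^sub>v \<bullet> u1) * (\<alpha>\<^sub>v \<bullet> v1)
          - (\<alpha>\<^sub>v \<bullet> \<beta>) * b u1 v1 * h' ?t * (k * x ?t)
          + (\<alpha>\<^sub>v \<bullet> \<beta>) * metric F j q u2 v2 * h' ?t * P ?t"
      by (rule local_hess_G[OF t pq(3) hd h'd H])
    have flat: "local_ricci (metric F j) q u2 v2 = 0"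
      using F(2) ij(3) pq(3) by (auto simp: ricci_flat_def ricci_def)
    \<comment> \<open>Since \<open>\<mu>' = z x^2\<close> contains the factor
      \<open>\<mu> = x\<close>, the whole derivative is a multiple of \<open>P\<close>, and the
      fibre block can be factored.\<close>
    have P': "P' ?t = P ?t * x ?t * (2 * k + 2 + z ?t)"
      unfolding P'_def P_def by (simp add: algebra_simps power2_eq_square)
    \<comment> \<open>The coefficients of \<open>b u1 v1\<close> and of the fibre metric cancel by
      the form of \<open>h'\<close>; \<open>N2\<close> acts only on the remaining coefficient,
      through \<open>h''\<close>.\<close>
    show "ricci ?M c y u v + hess ?M (\<lambda>(p, q). h (\<xi> p)) c y u v = 0"
      unfolding ricci_def hess_def pq(1) uv local_ricci_G[OF t pq(3)]
        hess flat P' h'_def h''_def N2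
      by (simp add: n(1) m(1) algebra_simps power2_eq_square)
  qed
  then show ?thesis by (simp add: B_def gB_def U_def)
qed

end
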